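(* Let $f\in V_\beta^\infty(\varphi)$, let $J\ge 2$, let $p_1<p_2<\cdots<p_J$ be real numbers and let $\gamma>0$ be such that $|f(p_j)|\ge\gamma$ for all $1\le j\le J$. Set $r:=\max_{1\le j\le J-1}(p_{j+1}-p_j)$ and $I:=[p_1-r,p_J+r]$. Then for every $g\in V_\beta^\infty(\varphi)$, $$\min_{\tau\in\mathbb{C},|\tau|=1}\|f-\tau g\|_{L^\infty(I)}\le\frac{16\sqrt2}{3}\left\lceil\frac J2\right\rceil e^{\frac{r^2}{4\sigma^2}}\,C(\sigma,\beta)\,\frac{\max\{1,\|f\|_{L^\infty(I)}+\|g\|_{L^\infty(I)}\}}{\min\{\gamma,\gamma^2\}}\,\bigl\||S_{\check\varphi}^{\mathbf A}f|^2-|S_{\check\varphi}^{\mathbf A}g|^2\bigr\|_{\frac\beta2,\infty}.$$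
   Context: Fix $\sigma>0$, $\beta>0$ and a real matrix $\mathbf A=\begin{pmatrix}a&b\\c&d\end{pmatrix}$ with $ad-bc=1$ and $b>0$. Gaussian: $\varphi(t)=e^{-t^2/(2\sigma^2)}$. Gaussian shift-invariant space: $V_\beta^\infty(\varphi)=\{\sum_{k\in\mathbb{Z}}c_k\varphi(\cdot-\beta k):(c_k)\in\ell^\infty(\mathbb{Z})\}$ with complex coefficients. Short-time linear canonical transform (STLCT) with window $\omega$: $S_\omega^{\mathbf A}f(x,\xi)=\int_{\mathbb{R}}f(t)\overline{\omega(t-x)}K_{\mathbf A}(\xi,t)\,dt$, where $K_{\mathbf A}(\xi,t)=\frac{1}{\sqrt{ib}}e^{\frac{i\pi}{b}(at^2-2\xi t+d\xi^2)}$. The window used is $\check\varphi(t)=e^{i\pi\frac{a}{b}t^2}\varphi(t)$. Mixed norm: for $\alpha>0$ and measurable $F$ on $\mathbb{R}^2$ (or on $\alpha\mathbb{Z}\times\mathbb{R}$), $\|F\|_{\alpha,\infty}=\sup_{n\in\mathbb{Z}}\|F(\alpha n,\cdot)\|_{L^1(\mathbb{R})}$. Constant: $C(\sigma,\beta)=\sup_{t\in\mathbb{R}}\sum_{n\in\mathbb{Z}}\bigl|\mathcal{F}^{-1}\Lambda(t-\tfrac\beta2n)\bigr|$, where $\mathcal{F}^{-1}\Lambda(t)=\int_{\mathbb{R}}\Lambda(u)e^{2\pi iut}du$, $\Lambda(t)=\dfrac{e^{-\pi^2\sigma^2t^2}}{\vartheta_3(\frac{\beta}{2}\pi t,\,e^{-\beta^2/(8\sigma^2)})}$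 and $\vartheta_3(z,q)=\sum_{n\in\mathbb{Z}}q^{n^2}e^{2niz}$. *)

theory Defs
  imports "HOL-Probability.Essential_Supremum"
begin

definition gauss :: "real \<Rightarrow> real \<Rightarrow> complex" where
  "gauss \<sigma> t = of_real (exp (- t\<^sup>2 / (2 * \<sigma>\<^sup>2)))"

text \<open>
  The elements of the Gaussian shift-invariant space are taken as genuine functions
  (the pointwise, absolutely convergent sums), so that point values of \<open>f\<close> make sense.
\<close>

definition gauss_SIS :: "real \<Rightarrow> real \<Rightarrow> (real \<Rightarrow> complex) set" where
  "gauss_SIS \<sigma> \<beta> = {f. \<exists>c :: int \<Rightarrow> complex. bounded (range c) \<and>
     (\<forall>t. ((\<lambda>k. c k * gauss \<sigma> (t - \<beta> * of_int k)) has_sum f t) UNIV)}"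

text \<open>
  For \<open>A\<close> with rows \<open>(a, b)\<close> and \<open>(c, d)\<close>, \<open>a = A $ 1 $ 1\<close>, \<open>b = A $ 1 $ 2\<close>, \<open>d = A $ 2 $ 2\<close>.
  The root of \<open>\<i> b\<close> is the principal one.
\<close>

definition lct_kernel :: "real^2^2 \<Rightarrow> real \<Rightarrow> real \<Rightarrow> complex" where
  "lct_kernel A \<xi> t = 1 / csqrt (\<i> * of_real (A $ 1 $ 2)) *
     exp (\<i> * of_real (pi / A $ 1 $ 2 * (A $ 1 $ 1 * t\<^sup>2 - 2 * \<xi> * t + A $ 2 $ 2 * \<xi>\<^sup>2)))"

definition STLCT ::
  "real^2^2 \<Rightarrow> (real \<Rightarrow> complex) \<Rightarrow> (real \<Rightarrow> complex) \<Rightarrow> real \<Rightarrow> real \<Rightarrow> complex" where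
  "STLCT A \<omega> f x \<xi> = (\<integral>t. f t * cnj (\<omega> (t - x)) * lct_kernel A \<xi> t \<partial>lborel)"

definition chirped_gauss :: "real \<Rightarrow> real^2^2 \<Rightarrow> real \<Rightarrow> complex" where
  "chirped_gauss \<sigma> A t = exp (\<i> * of_real (pi * (A $ 1 $ 1 / A $ 1 $ 2) * t\<^sup>2)) * gauss \<sigma> t"

text \<open>
  Norms and suprema that are a priori possibly infinite live in \<^typ>\<open>ennreal\<close>, where an
  infinite quantity has the value \<open>\<infinity>\<close> rather than a default real value.
\<close>

definition mixed_norm :: "real \<Rightarrow> (real \<Rightarrow> real \<Rightarrow> 'b::real_normed_vector) \<Rightarrow> ennreal" where
  "mixed_norm \<alpha> F = (SUP n::int. \<integral>\<^sup>+\<xi>. ennreal (norm (F (\<alpha> * of_int n) \<xi>)) \<partial>lborel)"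

definition Linf_norm :: "real set \<Rightarrow> (real \<Rightarrow> complex) \<Rightarrow> ennreal" where
  "Linf_norm I f = esssup (restrict_space lborel I) (\<lambda>t. ennreal (cmod (f t)))"

definition theta3 :: "complex \<Rightarrow> complex \<Rightarrow> complex" where
  "theta3 z q = (\<Sum>\<^sub>\<infinity>n::int. q powi (n\<^sup>2) * exp (2 * of_int n * \<i> * z))"

definition Lambda_fun :: "real \<Rightarrow> real \<Rightarrow> real \<Rightarrow> complex" where
  "Lambda_fun \<sigma> \<beta> t = of_real (exp (- (pi\<^sup>2 * \<sigma>\<^sup>2 * t\<^sup>2))) /
     theta3 (of_real (\<beta> / 2 * pi * t)) (of_real (exp (- \<beta>\<^sup>2 / (8 * \<sigma>\<^sup>2))))"

definition inv_fourier :: "(real \<Rightarrow> complex) \<Rightarrow> real \<Rightarrow> complex" where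
  "inv_fourier h t = (\<integral>u. h u * exp (2 * of_real pi * \<i> * of_real u * of_real t) \<partial>lborel)"

definition C_const :: "real \<Rightarrow> real \<Rightarrow> ennreal" where
  "C_const \<sigma> \<beta> = (SUP t::real. \<Sum>\<^sub>\<infinity>n::int.
     ennreal (cmod (inv_fourier (Lambda_fun \<sigma> \<beta>) (t - \<beta> / 2 * of_int n))))"

end

theory Submission
  imports Defs "HOL-Probability.Characteristic_Functions"
begin

text \<open>
  Up to a unimodular factor and a dilation of the frequency variable, the STLCT with the chirped
  window is the Gabor transform with a Gaussian window. Inverting the Fourier transform of the
  spectrogram at the position \<open>\<beta> n / 2\<close> gives, for every lag \<open>u\<close>, the convolution with
  \<open>exp (- t\<^sup>2 / \<sigma>\<^sup>2)\<close>, sampled at \<open>\<beta> n / 2\<close>, of the function \<open>s \<mapsto> f (s + u/2) cnj (f (s - u/2))\<close>,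
  which lies in the shift-invariant space of this Gaussian with step \<open>\<beta> / 2\<close>. In terms of
  coefficients this is a convolution with \<open>q^(n\<^sup>2)\<close>, whose symbol is \<open>\<theta>\<^sub>3\<close>; deconvolution
  costs the factor \<open>C(\<sigma>, \<beta>)\<close> and bounds \<open>f x cnj (f y) - g x cnj (g y)\<close> uniformly in terms of \<open>x - y\<close>.
  At each \<open>p\<^sub>j\<close> this determines a phase, valid within distance \<open>r\<close>; consecutive
  phases are compared through the same bound, and the phase at the middle point serves on all of \<open>I\<close>.

  If the mixed norm vanishes while \<open>C(\<sigma>, \<beta>)\<close> is a priori infinite, one needs that convolution with
  \<open>q^(n\<^sup>2)\<close> is bounded below on bounded sequences. This follows from the Jacobi triple product,
  which also keeps \<open>\<theta>\<^sub>3\<close> away from zero on the real line.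
\<close>

section \<open>Sums and integrals over countable index sets\<close>

text \<open>The constants have separate origins. Completing squares at lag u leaves the factor exp
  (u^2 / (4 \<sigma>^2)), and only lags up to r occur. The sqrt 2 is a quotient of two Gaussian
  normalizations, \<sigma> sqrt \<pi> from deconvolution and \<sigma> sqrt (\<pi> / 2) from the
  spectrogram. The nome exp (- \<beta>^2 / (8 \<sigma>^2)) comes from convolving exp (- t^2 /
  \<sigma>^2) with its translates by multiples of \<beta> / 2.

  A phase at p_j can be read off only if g (p_j) is nonzero. This is certain when the bilinear error
  is below \<gamma>^2; otherwise the claimed bound already exceeds the sum of the norms of f and g.
  The maximum and the minimum in the bound cover both cases.

  A symbol without zeros does not by itself give a lower bound in the supremum norm. The factors 1 +
  \<alpha> S do, S being the shift, because S is an isometry of bounded sequences.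

  Since 0 * \<infinity> = 0 in \<open>ennreal\<close>, an infinite factor must not meet a zero one
  unnoticed. If the mixed norm is 0, the left side must be shown to vanish; if it is \<infinity>,
  C(\<sigma>, \<beta>) must be shown to be positive.\<close>

lemma tannery_infsum:
  fixes a :: "nat \<Rightarrow> int \<Rightarrow> 'a :: {real_normed_algebra, banach}"
  assumes lim: "\<And>k. (\<lambda>N. a N k) \<longlonglongrightarrow> b k"
    and bound: "\<And>N k. norm (a N k) \<le> M k"
    and summ: "M summable_on UNIV"
  shows "(\<lambda>N. infsum (a N) UNIV) \<longlonglongrightarrow> infsum b UNIV"
proof -
  have bij: "bij int_decode" by (rule bij_int_decode)
  have Msum: "(\<lambda>i. M (int_decode i)) summable_on UNIV"
    using summ summable_on_reindex_bij_betw[OF bij, of M] by simp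
  have bbound: "norm (b k) \<le> M k" for k
    by (rule Lim_bounded[OF tendsto_norm[OF lim], of 0]) (use bound in auto)
  have eq: "infsum c UNIV = (\<Sum>i. c (int_decode i))" if "\<And>k. norm (c k) \<le> M k" for c :: "int \<Rightarrow> 'a"
  proof -
    have "(\<lambda>i. norm (c (int_decode i))) summable_on UNIV"
      by (rule Infinite_Sum.abs_summable_on_comparison_test'[OF Msum that])
    then have "((\<lambda>i. c (int_decode i)) has_sum (\<Sum>\<^sub>\<infinity>i. c (int_decode i))) UNIV"
      by (intro has_sum_infsum) (rule abs_summable_summable)
    then have "(\<Sum>i. c (int_decode i)) = (\<Sum>\<^sub>\<infinity>i. c (int_decode i))"
      by (intro sums_unique[symmetric] has_sum_imp_sums)
    also have "\<dots> = infsum c UNIV"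
      by (rule infsum_reindex_bij_betw[OF bij])
    finally show ?thesis by simp
  qed
  have "(\<lambda>N. \<Sum>i. a N (int_decode i)) \<longlonglongrightarrow> (\<Sum>i. b (int_decode i))"
    using tannerys_theorem[of "\<lambda>i N. a N (int_decode i)" "\<lambda>i. b (int_decode i)" sequentially "\<lambda>i. M (int_decode i)"]
      lim bound summable_on_imp_summable[OF Msum] by (auto intro!: always_eventually)
  then show ?thesis using eq bound bbound by simp
qed

text \<open>Enumerating the index set reduces this to termwise integration over \<open>nat\<close>.
  The index type is \<open>int\<close> for the expansions linear in f and
  \<open>int \<times> int\<close> for the spectrogram.\<close>

lemma has_bochner_integral_has_sum:
  fixes f :: "'i::countable \<Rightarrow> 'b \<Rightarrow> 'a::{banach, second_countable_topology}"
  assumes inf: "infinite (UNIV :: 'i set)"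
    and f: "\<And>i. has_bochner_integral M (f i) (v i)"
    and norms: "\<And>i. (\<integral>x. norm (f i x) \<partial>M) \<le> B i" "B summable_on UNIV"
    and absx: "\<And>x. x \<in> space M \<Longrightarrow> (\<lambda>i. norm (f i x)) summable_on UNIV"
    and F: "\<And>x. x \<in> space M \<Longrightarrow> ((\<lambda>i. f i x) has_sum F x) UNIV"
  shows "integrable M F" "(v has_sum integral\<^sup>L M F) UNIV"
proof -
  define h :: "nat \<Rightarrow> 'i" where "h = from_nat_into UNIV"
  have bij: "bij h" unfolding h_def by (rule bij_betw_from_nat_into) (use inf in auto)
  have int: "integrable M (f i)" and v: "v i = integral\<^sup>L M (f i)" for i
    using f by (auto simp: has_bochner_integral_iff)
  have Bs: "summable (\<lambda>n. B (h n))"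
    using norms(2) summable_on_reindex_bij_betw[OF bij, of B] by (simp add: summable_on_imp_summable)
  have s1: "AE x in M. summable (\<lambda>n. norm (f (h n) x))"
    using absx summable_on_reindex_bij_betw[OF bij, of "\<lambda>i. norm (f i _)"]
    by (auto intro!: AE_I2 summable_on_imp_summable)
  have s2: "summable (\<lambda>n. (\<integral>x. norm (f (h n) x) \<partial>M))"
    by (rule summable_comparison_test'[OF Bs, of 0]) (use norms(1) in auto)
  have Feq: "(\<Sum>n. f (h n) x) = F x" if "x \<in> space M" for x
    using F[OF that] has_sum_reindex_bij_betw[OF bij, of "\<lambda>i. f i x"]
    by (metis has_sum_imp_sums sums_unique)
  have "integrable M (\<lambda>x. \<Sum>n. f (h n) x)" by (rule integrable_suminf[OF int s1 s2])
  then show "integrable M F" using Feq by (metis (no_types, lifting) Bochner_Integration.integrable_cong)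
  have Ieq: "(\<Sum>n. v (h n)) = integral\<^sup>L M F"
    unfolding v integral_suminf[OF int s1 s2, symmetric]
    by (rule Bochner_Integration.integral_cong) (auto simp: Feq)
  have "(\<lambda>i. norm (v i)) summable_on UNIV"
  proof (rule Infinite_Sum.abs_summable_on_comparison_test'[OF norms(2)])
    show "norm (v i) \<le> B i" for i
      unfolding v using integral_norm_bound[of M "f i"] norms(1)[of i] by linarith
  qed
  then have "v summable_on UNIV" by (rule abs_summable_summable)
  then have hs: "(v has_sum infsum v UNIV) UNIV" by simp
  then have "((\<lambda>n. v (h n)) has_sum infsum v UNIV) UNIV"
    using has_sum_reindex_bij_betw[OF bij, of v] by simp
  then have "(\<Sum>n. v (h n)) = infsum v UNIV" by (metis has_sum_imp_sums sums_unique)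
  then show "(v has_sum integral\<^sup>L M F) UNIV" using hs Ieq by simp
qed

lemma summable_on_power_nat_abs:
  fixes x :: real
  assumes "0 \<le> x" "x < 1"
  shows "(\<lambda>k::int. x ^ nat \<bar>k\<bar>) summable_on UNIV"
proof -
  have geo: "(\<lambda>n. x ^ n) summable_on UNIV"
    using assms by (intro summable_nonneg_imp_summable_on) (auto intro: summable_geometric)
  have 1: "(\<lambda>k::int. x ^ nat \<bar>k\<bar>) summable_on range int"
    by (subst summable_on_reindex) (use geo in \<open>auto simp: o_def\<close>)
  have 2: "(\<lambda>k::int. x ^ nat \<bar>k\<bar>) summable_on range (\<lambda>n. - int n)"
    by (subst summable_on_reindex) (use geo in \<open>auto simp: o_def inj_on_def\<close>)
  have "(UNIV :: int set) = range int \<union> range (\<lambda>n. - int n)"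
  proof -
    have "k \<in> range int \<union> range (\<lambda>n. - int n)" for k by (cases k rule: int_cases2) auto
    then show ?thesis by auto
  qed
  then show ?thesis using summable_on_union[OF 1 2] by simp
qed

lemma summable_powi_square:
  assumes "0 < q" "q < (1::real)"
  shows "(\<lambda>j::int. q powi (j\<^sup>2)) summable_on UNIV"
proof (rule summable_on_comparison_test)
  show "(\<lambda>k::int. q ^ nat \<bar>k\<bar>) summable_on UNIV" using assms by (intro summable_on_power_nat_abs) auto
  fix k :: int
  have "\<bar>k\<bar> \<le> k\<^sup>2"
    using mult_left_mono[of 1 "\<bar>k\<bar>" "\<bar>k\<bar>"] by (cases "k = 0") (auto simp: power2_eq_square)
  then have "nat \<bar>k\<bar> \<le> nat (k\<^sup>2)" by (rule nat_mono)
  then have "q ^ nat (k\<^sup>2) \<le> q ^ nat \<bar>k\<bar>" using assms by (intro power_decreasing) auto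
  then show "q powi (k\<^sup>2) \<le> q ^ nat \<bar>k\<bar>" by (simp add: power_int_def)
qed (use assms in auto)

text \<open>Periodicity makes the bound uniform in x: shifting k moves x into [0, \<beta>), where
  every term is at most exp (s \<beta>^2) q^(k^2).\<close>

lemma gauss_sum_bound:
  fixes s \<beta> :: real
  assumes "s > 0" "\<beta> > 0"
  obtains B where "\<And>x. (\<lambda>k::int. exp (- s * (\<beta> * of_int k - x)\<^sup>2)) summable_on UNIV"
    "\<And>x. (\<Sum>\<^sub>\<infinity>k::int. exp (- s * (\<beta> * of_int k - x)\<^sup>2)) \<le> B"
proof -
  define q where "q = exp (- s * \<beta>\<^sup>2 / 2)"
  have q: "0 < q" "q < 1" using assms by (auto simp: q_def)
  have le: "exp (- s * (\<beta> * of_int k - x)\<^sup>2) \<le> exp (s * x\<^sup>2) * q powi (k\<^sup>2)" for x and k :: int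
  proof -
    \<comment> \<open>This square is twice the difference of the two sides of the next
      inequality.\<close>
    have "0 \<le> (\<beta> * of_int k - 2 * x)\<^sup>2" by simp
    then have "\<beta>\<^sup>2 * (of_int k)\<^sup>2 / 2 - x\<^sup>2 \<le> (\<beta> * of_int k - x)\<^sup>2"
      by (simp add: power2_eq_square algebra_simps)
    then have "s * (\<beta>\<^sup>2 * (of_int k)\<^sup>2 / 2 - x\<^sup>2) \<le> s * (\<beta> * of_int k - x)\<^sup>2"
      using assms by (intro mult_left_mono) auto
    then have "- s * (\<beta> * of_int k - x)\<^sup>2 \<le> s * x\<^sup>2 + (-s * \<beta>\<^sup>2 / 2) * (of_int k)\<^sup>2"
      by (simp add: right_diff_distrib)
    moreover have "q powi (k\<^sup>2) = exp ((-s * \<beta>\<^sup>2 / 2) * (of_int k)\<^sup>2)"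
      unfolding q_def by (simp only: exp_power_int of_int_power mult.commute)
    ultimately show ?thesis by (simp only: exp_add[symmetric] exp_le_cancel_iff)
  qed
  have summ: "(\<lambda>k::int. c * q powi (k\<^sup>2)) summable_on UNIV" for c
    by (intro summable_on_cmult_right summable_powi_square q)
  have S: "(\<lambda>k::int. exp (- s * (\<beta> * of_int k - x)\<^sup>2)) summable_on UNIV" for x
    by (rule summable_on_comparison_test[OF summ le]) auto
  have "(\<Sum>\<^sub>\<infinity>k::int. exp (- s * (\<beta> * of_int k - x)\<^sup>2)) \<le> (\<Sum>\<^sub>\<infinity>k::int. exp (s * \<beta>\<^sup>2) * q powi (k\<^sup>2))" for x
  proof -
    define m where "m = \<lfloor>x / \<beta>\<rfloor>"
    have "(\<Sum>\<^sub>\<infinity>k::int. exp (- s * (\<beta> * of_int k - x)\<^sup>2)) = (\<Sum>\<^sub>\<infinity>k::int. exp (- s * (\<beta> * of_int (k + m) - x)\<^sup>2))"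
      by (rule infsum_reindex_bij_witness[of _ "\<lambda>k. k + m" "\<lambda>k. k - m"]) auto
    also have "\<dots> = (\<Sum>\<^sub>\<infinity>k::int. exp (- s * (\<beta> * of_int k - (x - \<beta> * m))\<^sup>2))"
      by (simp add: algebra_simps)
    also have "\<dots> \<le> (\<Sum>\<^sub>\<infinity>k::int. exp (s * \<beta>\<^sup>2) * q powi (k\<^sup>2))"
    proof (rule infsum_mono[OF S summ])
      fix k :: int
      have m: "of_int m \<le> x / \<beta>" "x / \<beta> < of_int m + 1" unfolding m_def by linarith+
      then have "0 \<le> x - \<beta> * m" "x - \<beta> * m \<le> \<beta>" using assms by (auto simp: field_simps)
      then have "(x - \<beta> * m)\<^sup>2 \<le> \<beta>\<^sup>2" by (intro power_mono)
      then have "exp (s * (x - \<beta> * m)\<^sup>2) \<le> exp (s * \<beta>\<^sup>2)" using assms by simp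
      then have "exp (s * (x - \<beta> * m)\<^sup>2) * q powi (k\<^sup>2) \<le> exp (s * \<beta>\<^sup>2) * q powi (k\<^sup>2)"
        using q by (intro mult_right_mono) auto
      then show "exp (- s * (\<beta> * of_int k - (x - \<beta> * m))\<^sup>2) \<le> exp (s * \<beta>\<^sup>2) * q powi (k\<^sup>2)"
        using le[of k "x - \<beta> * m"] by linarith
    qed
    finally show ?thesis .
  qed
  then show thesis using that[of "\<Sum>\<^sub>\<infinity>k::int. exp (s * \<beta>\<^sup>2) * q powi (k\<^sup>2)"] S by blast
qed

section \<open>Convolution with the theta sequence\<close>

text \<open>
  \<open>qbin q M k\<close> is \<open>q^(k (k - 1))\<close> times the Gaussian binomial coefficient of \<open>M\<close> over \<open>k\<close> in base
  \<open>q\<^sup>2\<close>, that is, the coefficient of \<open>y^k\<close> in \<open>(1 + y) (1 + y q\<^sup>2) \<cdots> (1 + y q^(2 M - 2))\<close>.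
\<close>

fun qbin :: "real \<Rightarrow> nat \<Rightarrow> nat \<Rightarrow> real" where
  "qbin q 0 0 = 1"
| "qbin q 0 (Suc k) = 0"
| "qbin q (Suc M) 0 = qbin q M 0"
| "qbin q (Suc M) (Suc k) = qbin q M (Suc k) + q ^ (2 * M) * qbin q M k"

text \<open>The q-Pochhammer symbol (q^2; q^2)_n, which plays the role of the factorial in base
  q^2.\<close>

definition qpoch :: "real \<Rightarrow> nat \<Rightarrow> real" where
  "qpoch q n = (\<Prod>i<n. 1 - q ^ (2 * Suc i))"

lemma qpoch_0 [simp]: "qpoch q 0 = 1"
  and qpoch_Suc: "qpoch q (Suc n) = qpoch q n * (1 - q ^ (2 * Suc n))"
  by (simp_all add: qpoch_def)

lemma qbin_eq_0: "k > M \<Longrightarrow> qbin q M k = 0"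
  by (induction q M k rule: qbin.induct) auto

lemma qbin_0_right [simp]: "qbin q M 0 = 1"
  by (induction M) auto

text \<open>Pascal's rule leaves the two terms 1 - q^(2 (M - k)) and q^(2 (M - k)) (1 - q^(2 (k +
  1))), whose sum telescopes to the new factor 1 - q^(2 (M + 1)). The product form avoids dividing
  by \<open>qpoch\<close>, which may vanish for a general q.\<close>

lemma qbin_qpoch:
  assumes "k \<le> M"
  shows "qbin q M k * qpoch q k * qpoch q (M - k) = q ^ (k * (k - 1)) * qpoch q M"
  using assms
proof (induction q M k rule: qbin.induct)
  case (4 q M k)
  have pow: "q ^ (2 * M) * q ^ (k * (k - 1)) = q ^ (Suc k * k) * q ^ (2 * (M - k))"
  proof -
    have "2 * M + k * (k - 1) = Suc k * k + 2 * (M - k)"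
      using 4 by (cases k) (auto simp: algebra_simps)
    then show ?thesis by (metis power_add)
  qed
  have pow2: "q ^ (2 * (M - k)) * q ^ (2 * Suc k) = q ^ (2 * Suc M)"
  proof -
    have "2 * (M - k) + 2 * Suc k = 2 * Suc M" using 4 by simp
    then show ?thesis by (metis power_add)
  qed
  have IH2: "qbin q M k * qpoch q k * qpoch q (M - k) = q ^ (k * (k - 1)) * qpoch q M"
    using 4 by simp
  have A: "qbin q M (Suc k) * qpoch q (Suc k) * qpoch q (M - k)
      = q ^ (Suc k * k) * qpoch q M * (1 - q ^ (2 * (M - k)))"
  \<comment> \<open>For k = M both sides are 0, on the right through 1 - q^0; the induction
    hypothesis reaches only k < M.\<close>
  proof (cases "k = M")
    case True
    then show ?thesis by (simp add: qbin_eq_0)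
  next
    case False
    then have "Suc k \<le> M" using 4 by simp
    then have IH1: "qbin q M (Suc k) * qpoch q (Suc k) * qpoch q (M - Suc k) = q ^ (Suc k * k) * qpoch q M"
      using 4(1) by simp
    have "qpoch q (M - k) = qpoch q (M - Suc k) * (1 - q ^ (2 * (M - k)))"
      using qpoch_Suc[of q "M - Suc k"] \<open>Suc k \<le> M\<close> by (simp add: Suc_diff_Suc)
    then show ?thesis by (metis IH1 mult.assoc)
  qed
  have "qbin q (Suc M) (Suc k) * qpoch q (Suc k) * qpoch q (Suc M - Suc k)
     = qbin q M (Suc k) * qpoch q (Suc k) * qpoch q (M - k)
      + q ^ (2 * M) * (qbin q M k * qpoch q k * qpoch q (M - k)) * (1 - q ^ (2 * Suc k))"
    by (simp add: qpoch_Suc algebra_simps)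
  also have "\<dots> = q ^ (Suc k * k) * qpoch q M * (1 - q ^ (2 * (M - k)))
      + (q ^ (2 * M) * q ^ (k * (k - 1))) * qpoch q M * (1 - q ^ (2 * Suc k))"
    unfolding A IH2 by (simp only: mult.assoc)
  also have "\<dots> = q ^ (Suc k * k) * qpoch q M * (1 - q ^ (2 * (M - k)) * q ^ (2 * Suc k))"
    unfolding pow by (simp only: algebra_simps)
  also have "\<dots> = q ^ (Suc k * (Suc k - 1)) * qpoch q (Suc M)"
    unfolding pow2 qpoch_Suc by simp
  finally show ?case .
qed auto

text \<open>
  With \<open>y\<close> replaced by \<open>y\<close> times the shift operator, the product becomes an operator that is
  bounded below factor by factor. For \<open>y = q^(1 - 2 N)\<close> and \<open>M = 2 N\<close> its kernel is, up to
  a scalar, \<open>q^(j\<^sup>2)\<close> times \<open>qratio q N j\<close>, which tends to a constant as \<open>N \<rightarrow> \<infinity>\<close>.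
\<close>

definition qsum :: "real \<Rightarrow> real \<Rightarrow> nat \<Rightarrow> (int \<Rightarrow> complex) \<Rightarrow> int \<Rightarrow> complex" where
  "qsum q y M d n = (\<Sum>k\<le>M. of_real (qbin q M k * y ^ k) * d (n + int k))"

text \<open>In operator form, one more step composes with 1 + y q^(2 M) S, where S shifts the
  argument by 1. This is Pascal's rule for \<open>qbin\<close>.\<close>

lemma qsum_Suc:
  "qsum q y (Suc M) d n = qsum q y M d n + of_real (y * q ^ (2 * M)) * qsum q y M d (n + 1)"
proof -
  have "qsum q y M d n = (\<Sum>k\<le>Suc M. of_real (qbin q M k * y ^ k) * d (n + int k))"
    unfolding qsum_def by (simp add: qbin_eq_0)
  also have "\<dots> = d n + (\<Sum>k\<le>M. of_real (qbin q M (Suc k) * y ^ Suc k) * d (n + int (Suc k)))"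
    by (subst sum.atMost_Suc_shift) simp
  finally have 1: "qsum q y M d n = \<dots>" .
  have "qsum q y (Suc M) d n
     = d n + (\<Sum>k\<le>M. of_real (qbin q (Suc M) (Suc k) * y ^ Suc k) * d (n + int (Suc k)))"
    unfolding qsum_def by (subst sum.atMost_Suc_shift) simp
  then show ?thesis
    unfolding 1 by (simp add: qsum_def sum_distrib_left flip: sum.distrib)
      (intro sum.cong, auto simp: algebra_simps)
qed

text \<open>The shift is an isometry for the supremum norm X, so the reverse triangle inequality
  applies: solve for x n if \<alpha> \<le> 1 and for x (n + 1) otherwise. Boundedness is essential,
  since (-1/\<alpha>)^n is annihilated.\<close>

lemma bounded_shift_lower_bound:
  fixes x :: "int \<Rightarrow> complex" and \<alpha> B :: real
  assumes bdd: "bounded (range x)" and "\<alpha> \<ge> 0"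
    and B: "\<And>n. cmod (x n + of_real \<alpha> * x (n + 1)) \<le> B"
  shows "cmod (x n) * \<bar>1 - \<alpha>\<bar> \<le> B"
proof -
  define X where "X = (SUP n. cmod (x n))"
  have bdd': "bdd_above (range (\<lambda>n. cmod (x n)))"
    using bdd by (auto simp: bounded_iff bdd_above_def)
  have le_X: "cmod (x n) \<le> X" for n
    unfolding X_def by (rule cSUP_upper[OF _ bdd']) simp
  have nn: "0 \<le> X" using le_X[of 0] norm_ge_zero order_trans by blast
  have b1: "X \<le> B + \<alpha> * X"
    unfolding X_def
  proof (rule cSUP_least)
    fix n :: int
    have "cmod (x n) \<le> cmod (x n + of_real \<alpha> * x (n + 1)) + cmod (of_real \<alpha> * x (n + 1))"
      using norm_triangle_sub[of "x n" "- (of_real \<alpha> * x (n + 1))"] by simp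
    also have "\<dots> \<le> B + \<alpha> * X"
      using B[of n] le_X[of "n + 1"] \<open>\<alpha> \<ge> 0\<close> by (simp add: norm_mult mult_left_mono add_mono)
    finally show "cmod (x n) \<le> B + \<alpha> * (SUP n. cmod (x n))" by (simp add: X_def)
  qed auto
  have b2: "\<alpha> * cmod (x n) \<le> B + X" for n
  proof -
    have "\<alpha> * cmod (x n) = cmod (of_real \<alpha> * x (n - 1 + 1))" using \<open>\<alpha> \<ge> 0\<close> by (simp add: norm_mult)
    also have "\<dots> \<le> cmod (x (n - 1) + of_real \<alpha> * x (n - 1 + 1)) + cmod (x (n - 1))"
      by (metis add.commute norm_triangle_sub add_diff_cancel_left' norm_minus_commute norm_triangle_ineq4)
    also have "\<dots> \<le> B + X" using B[of "n - 1"] le_X[of "n - 1"] by (intro add_mono) auto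
    finally show ?thesis .
  qed
  show ?thesis
  proof (cases "\<alpha> \<le> 1")
    case True
    have "cmod (x n) * \<bar>1 - \<alpha>\<bar> \<le> X * (1 - \<alpha>)" using True le_X by (simp add: mult_right_mono)
    also have "\<dots> \<le> B" using b1 by (simp add: algebra_simps)
    finally show ?thesis .
  next
    case False
    have "X \<le> (B + X) / \<alpha>" unfolding X_def
      by (rule cSUP_least) (use False b2 in \<open>auto simp: field_simps X_def\<close>)
    then have "X * (\<alpha> - 1) \<le> B" using False by (simp add: field_simps)
    moreover have "cmod (x n) * \<bar>1 - \<alpha>\<bar> \<le> X * (\<alpha> - 1)" using False le_X by (simp add: mult_right_mono)
    ultimately show ?thesis by simp
  qed
qed

lemma bounded_qsum:
  assumes "bounded (range d)"
  shows "bounded (range (qsum q y M d))"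
proof -
  obtain D where D: "\<And>n. cmod (d n) \<le> D" using assms by (auto simp: bounded_iff)
  show ?thesis
    unfolding bounded_iff
  proof (intro exI ballI, clarify)
    fix n
    show "cmod (qsum q y M d n) \<le> (\<Sum>k\<le>M. \<bar>qbin q M k * y ^ k\<bar> * D)"
      unfolding qsum_def by (intro sum_norm_le) (auto simp: norm_mult abs_mult norm_power power_abs intro!: mult_left_mono D)
  qed
qed

text \<open>The last factor is removed first, because by \<open>qsum_Suc\<close> it acts on the
  output of the others. That output is bounded by \<open>bounded_qsum\<close>, so the estimate for a
  single factor applies to it.\<close>

lemma qsum_lower_bound:
  assumes "bounded (range d)" "0 < q" "y \<ge> 0"
    and "\<And>n. cmod (qsum q y M d n) \<le> B"
  shows "cmod (d n) * (\<Prod>j<M. \<bar>1 - y * q ^ (2 * j)\<bar>) \<le> B"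
  using assms(4)
proof (induction M arbitrary: B n)
  case 0
  then show ?case by (simp add: qsum_def)
next
  case (Suc M)
  let ?c = "\<bar>1 - y * q ^ (2 * M)\<bar>"
  have main: "cmod (qsum q y M d n) * ?c \<le> B" for n
  proof (rule bounded_shift_lower_bound)
    show "cmod (qsum q y M d n + of_real (y * q ^ (2 * M)) * qsum q y M d (n + 1)) \<le> B" for n
      using Suc.prems[of n] by (simp only: qsum_Suc)
  qed (use assms in \<open>auto simp: bounded_qsum\<close>)
  have Bnn: "B \<ge> 0" using Suc.prems norm_ge_zero order_trans by blast
  show ?case
  proof (cases "?c = 0")
    case True
    then show ?thesis using Bnn by simp
  next
    case False
    then have "?c > 0" by simp
    then have "cmod (qsum q y M d n) \<le> B / ?c" for n using main by (simp add: pos_le_divide_eq)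
    then have "cmod (d n) * (\<Prod>j<M. \<bar>1 - y * q ^ (2 * j)\<bar>) \<le> B / ?c" using Suc.IH by blast
    then show ?thesis using \<open>?c > 0\<close> by (simp add: pos_le_divide_eq mult.assoc)
  qed
qed

text \<open>The q-Pochhammer symbol (q; q^2)_N; its square appears in the triple product for theta
  at \<pi>/2.\<close>

definition qodd :: "real \<Rightarrow> nat \<Rightarrow> real" where
  "qodd q N = (\<Prod>i<N. 1 - q ^ (2 * i + 1))"

text \<open>The Gaussian binomial coefficient of 2 N over N + j in base q^2, extended by 0 so that
  it can be summed over all integers j.\<close>

definition qratio :: "real \<Rightarrow> nat \<Rightarrow> int \<Rightarrow> real" where
  "qratio q N j = (if \<bar>j\<bar> \<le> int N then qpoch q (2 * N) / (qpoch q (nat (int N + j)) * qpoch q (nat (int N - j))) else 0)"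

lemma qpoch_pos: "0 < q \<Longrightarrow> q < 1 \<Longrightarrow> 0 < qpoch q n"
  unfolding qpoch_def by (intro prod_pos) (auto simp: power_Suc_less_one simp del: power_Suc intro!: power_less_one_iff[THEN iffD2])

text \<open>The exponents 1 - 2 N + 2 j run through the odd numbers from -(2 N - 1) to 2 N - 1. A
  negative one contributes |1 - q^(-i)| = q^(-i) (1 - q^i), and the powers collected are q^(-(1 + 3
  + ... + (2 N - 1))) = q^(-N^2).\<close>

lemma prod_odd_eq:
  assumes "0 < q" "q < 1"
  shows "(\<Prod>j<2 * N. \<bar>1 - q / q ^ (2 * N) * q ^ (2 * j)\<bar>) * q ^ (N * N) = (qodd q N)\<^sup>2"
proof -
  have pw: "q ^ n < 1" if "n > 0" for n using assms that by (simp add: power_less_one_iff)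
  have split: "{..<2 * N} = {..<N} \<union> {N..<2 * N}" by auto
  let ?F = "\<lambda>j. \<bar>1 - q / q ^ (2 * N) * q ^ (2 * j)\<bar>"
  have hi: "prod ?F {N..<2 * N} = qodd q N"
  proof -
    have "prod ?F {N..<2 * N} = (\<Prod>i<N. ?F (i + N))"
      by (rule prod.reindex_bij_witness[of _ "\<lambda>i. i + N" "\<lambda>j. j - N"]) auto
    also have "\<dots> = qodd q N" unfolding qodd_def
    proof (rule prod.cong[OF refl])
      fix i assume "i \<in> {..<N}"
      have "q / q ^ (2 * N) * q ^ (2 * (i + N)) = q ^ (2 * i + 1)"
        using assms by (simp add: power_add add_mult_distrib2)
      then show "?F (i + N) = 1 - q ^ (2 * i + 1)" using pw[of "2 * i + 1"] by simp
    qed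
    finally show ?thesis .
  qed
  have sq: "q ^ (N * N) = (\<Prod>i<N. q ^ (2 * i + 1))"
  proof (induction N)
    case (Suc N)
    have "Suc N * Suc N = N * N + (2 * N + 1)" by simp
    then show ?case using Suc by (simp only: power_add prod.lessThan_Suc)
  qed simp
  have lo: "prod ?F {..<N} * q ^ (N * N) = qodd q N"
  proof -
    have "prod ?F {..<N} = (\<Prod>i<N. ?F (N - Suc i))"
      by (rule prod.nat_diff_reindex[symmetric])
    then have "prod ?F {..<N} * q ^ (N * N) = (\<Prod>i<N. ?F (N - Suc i) * q ^ (2 * i + 1))"
      by (simp add: sq prod.distrib)
    also have "\<dots> = qodd q N" unfolding qodd_def
    proof (rule prod.cong[OF refl])
      fix i assume i: "i \<in> {..<N}"
      let ?p = "q ^ (2 * i + 1)"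
      have "q ^ (2 * N) = ?p * (q * q ^ (2 * (N - Suc i)))"
      proof -
        have "2 * N = (2 * i + 1) + Suc (2 * (N - Suc i))" using i by auto
        then show ?thesis by (metis power_add power_Suc)
      qed
      then have "q / q ^ (2 * N) * q ^ (2 * (N - Suc i)) = 1 / ?p" using assms by (simp add: field_simps)
      then have "?F (N - Suc i) = 1 / ?p - 1" using pw[of "2 * i + 1"] assms by (simp add: field_simps)
      then show "?F (N - Suc i) * ?p = 1 - ?p" using assms by (simp add: field_simps)
    qed
    finally show ?thesis .
  qed
  have "prod ?F {..<2 * N} = prod ?F {..<N} * prod ?F {N..<2 * N}"
    unfolding split by (rule prod.union_disjoint) auto
  then show ?thesis using hi lo by (simp add: power2_eq_square)
qed

text \<open>The choice y = q^(1 - 2 N) and the prefactor q^(N^2) complete the square: N^2 + k (k -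
  1) + (1 - 2 N) k = (k - N)^2, with j = k - N.\<close>

lemma qsum_eq_qratio:
  assumes "0 < q" "q < 1"
  shows "of_real (q ^ (N * N)) * qsum q (q / q ^ (2 * N)) (2 * N) d n
    = (\<Sum>j\<in>{-int N..int N}. of_real (q powi (j\<^sup>2) * qratio q N j) * d (n + int N + j))"
proof -
  have "of_real (q ^ (N * N)) * qsum q (q / q ^ (2 * N)) (2 * N) d n =
    (\<Sum>k\<le>2 * N. of_real (q ^ (N * N) * (qbin q (2 * N) k * (q / q ^ (2 * N)) ^ k)) * d (n + int k))"
    unfolding qsum_def by (simp add: sum_distrib_left mult.assoc)
  also have "\<dots> = (\<Sum>j\<in>{-int N..int N}. of_real (q powi (j\<^sup>2) * qratio q N j) * d (n + int N + j))"
  proof (rule sum.reindex_bij_witness[of _ "\<lambda>j. nat (j + int N)" "\<lambda>k. int k - int N"], goal_cases)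
    case (5 k)
    let ?y = "q / q ^ (2 * N)"
    have k: "k \<le> 2 * N" using 5 by simp
    have "qbin q (2 * N) k = q ^ (k * (k - 1)) * qpoch q (2 * N) / (qpoch q k * qpoch q (2 * N - k))"
      using qbin_qpoch[OF k, of q] qpoch_pos[OF assms, of k] qpoch_pos[OF assms, of "2 * N - k"] by (simp add: field_simps)
    also have "\<dots> = q ^ (k * (k - 1)) * qratio q N (int k - int N)"
    proof -
      have "nat (int N + (int k - int N)) = k" "nat (int N - (int k - int N)) = 2 * N - k" "\<bar>int k - int N\<bar> \<le> int N"
        using k by auto
      then show ?thesis by (simp add: qratio_def)
    qed
    finally have 1: "qbin q (2 * N) k = q ^ (k * (k - 1)) * qratio q N (int k - int N)" .
    have "q ^ (N * N) * (q ^ (k * (k - 1)) * ?y ^ k) = q powi (int (N * N)) * (q powi (int (k * (k - 1))) * ((q powi 1) / (q powi (int (2 * N)))) powi (int k))"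
      by (simp only: power_int_of_nat power_int_1_right)
    also have "\<dots> = q powi (int (N * N) + int (k * (k - 1)) + (1 - int (2 * N)) * int k)"
      using assms by (simp add: power_int_add power_int_mult power_int_diff)
    also have "int (N * N) + int (k * (k - 1)) + (1 - int (2 * N)) * int k = (int k - int N)\<^sup>2"
      by (cases k) (auto simp: power2_eq_square algebra_simps)
    finally have 2: "q ^ (N * N) * (q ^ (k * (k - 1)) * ?y ^ k) = q powi ((int k - int N)\<^sup>2)" .
    show ?case unfolding 1 using 2 by (simp add: algebra_simps flip: of_real_mult)
  qed auto
  finally show ?thesis .
qed

text \<open>All factors are positive and their distances from 1 are summable, so the infinite
  products are positive. As \<open>qpoch\<close> decreases, it stays above its limit, which later
  makes \<open>qratio\<close> bounded uniformly in N and j.\<close>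

lemma qprod_limits:
  assumes "0 < q" "q < 1"
  shows "\<exists>P>0. qpoch q \<longlonglongrightarrow> P \<and> (\<forall>n. P \<le> qpoch q n)"
    and "\<exists>P>0. qodd q \<longlonglongrightarrow> P"
proof -
  have *: "\<exists>P>0. (\<lambda>n. \<Prod>i<n. 1 - q ^ (2 * i + c)) \<longlonglongrightarrow> P" if "c > 0" for c
  proof -
    let ?f = "\<lambda>i. 1 - q ^ (2 * i + c)"
    have pos: "?f i > 0" for i using assms that by (simp add: power_less_one_iff)
    have "summable (\<lambda>i. q ^ (2 * i + c))"
      unfolding power_add power_mult using assms by (intro summable_mult2 summable_geometric) (auto simp: power_less_one_iff)
    then have "abs_convergent_prod ?f"
      using assms by (intro summable_imp_abs_convergent_prod) (simp add: norm_power)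
    then have cp: "convergent_prod ?f" by (rule abs_convergent_prod_imp_convergent_prod)
    show ?thesis
      using less_0_prodinf[OF cp pos] convergent_prod_LIMSEQ[OF cp] by (auto simp: LIMSEQ_lessThan_iff_atMost)
  qed
  show "\<exists>P>0. qodd q \<longlonglongrightarrow> P" using *[of 1] by (simp add: qodd_def[abs_def])
  from *[of 2] obtain P where P: "P > 0" "qpoch q \<longlonglongrightarrow> P"
    by (auto simp: qpoch_def[abs_def] mult_2)
  have "decseq (qpoch q)"
    by (rule decseq_SucI) (use qpoch_pos[OF assms] assms in \<open>auto simp: qpoch_Suc mult_left_le\<close>)
  then show "\<exists>P>0. qpoch q \<longlonglongrightarrow> P \<and> (\<forall>n. P \<le> qpoch q n)"
    using P decseq_ge by blast
qed

lemma tendsto_nat_int_shift: "filterlim (\<lambda>N. nat (int N + j)) sequentially sequentially"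
  unfolding filterlim_at_top
proof
  fix Z :: nat
  show "\<forall>\<^sub>F N in sequentially. Z \<le> nat (int N + j)"
    using eventually_ge_at_top[of "Z + nat \<bar>j\<bar>"] by eventually_elim auto
qed

text \<open>The finite product has kernel q^(j^2) \<open>qratio q N j\<close> instead of q^(j^2) /
  P. The discrepancy costs \<open>e N * D\<close>, where D bounds d; it vanishes as N grows, so K
  depends on q alone.\<close>

lemma theta_convolution_bounded_below:
  assumes q: "0 < q" "q < 1"
  obtains K where "K > 0"
    "\<And>(d :: int \<Rightarrow> complex) B n. bounded (range d) \<Longrightarrow>
      (\<And>n. cmod (\<Sum>\<^sub>\<infinity>j. of_real (q powi (j\<^sup>2)) * d (n + j)) \<le> B) \<Longrightarrow> cmod (d n) \<le> K * B"
proof -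
  from qprod_limits(1)[OF q] obtain P where P: "P > 0" "qpoch q \<longlonglongrightarrow> P" "\<And>n. P \<le> qpoch q n" by blast
  from qprod_limits(2)[OF q] obtain R where R: "R > 0" "qodd q \<longlonglongrightarrow> R" by blast
  have poch1: "qpoch q n \<le> 1" for n
    unfolding qpoch_def using q by (intro prod_le_1) (auto intro!: power_le_one simp del: power_Suc mult_Suc_right)
  note pos = qpoch_pos[OF q]
  define e where "e N = (\<Sum>\<^sub>\<infinity>j::int. q powi (j\<^sup>2) * \<bar>qratio q N j - 1 / P\<bar>)" for N
  have qr_bound: "\<bar>qratio q N j - 1 / P\<bar> \<le> 1 / P\<^sup>2 + 1 / P" for N j
  proof -
    have "qpoch q (2 * N) / (qpoch q a * qpoch q b) \<le> 1 / (P * P)" for a b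
      using P pos[of a] pos[of b] poch1[of "2 * N"] by (intro frac_le mult_mono) (auto simp: less_imp_le)
    moreover have "0 \<le> qpoch q (2 * N) / (qpoch q a * qpoch q b)" for a b
      using pos by (simp add: less_imp_le)
    ultimately have "0 \<le> qratio q N j \<and> qratio q N j \<le> 1 / P\<^sup>2"
      using P by (auto simp: qratio_def power2_eq_square)
    then show ?thesis using P by (auto simp: abs_le_iff intro: add_increasing)
  qed
  have qr_lim: "(\<lambda>N. qratio q N j) \<longlonglongrightarrow> 1 / P" for j
  proof -
    \<comment> \<open>The quotient formula for \<open>qratio\<close> is valid only once N \<ge>
      |j|.\<close>
    have ev: "\<forall>\<^sub>F N in sequentially. qpoch q (2 * N) / (qpoch q (nat (int N + j)) * qpoch q (nat (int N + - j))) = qratio q N j"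
      using eventually_ge_at_top[of "nat \<bar>j\<bar>"] by eventually_elim (auto simp: qratio_def)
    have sub: "filterlim (\<lambda>N. 2 * N) sequentially (sequentially :: nat filter)"
      by (rule filterlim_subseq) (auto simp: strict_mono_def)
    have "(\<lambda>N. qpoch q (2 * N)) \<longlonglongrightarrow> P"
      by (rule filterlim_compose[OF P(2) sub])
    moreover have "(\<lambda>N. qpoch q (nat (int N + i))) \<longlonglongrightarrow> P" for i
      by (rule filterlim_compose[OF P(2) tendsto_nat_int_shift])
    ultimately have "(\<lambda>N. qpoch q (2 * N) / (qpoch q (nat (int N + j)) * qpoch q (nat (int N + - j)))) \<longlonglongrightarrow> P / (P * P)"
      using P(1) by (intro tendsto_divide tendsto_mult) (assumption | simp)+
    from Lim_transform_eventually[OF this ev] show ?thesis using P by simp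
  qed
  have summ: "(\<lambda>j::int. q powi (j\<^sup>2)) summable_on UNIV" by (rule summable_powi_square[OF q])
  have summ_c: "(\<lambda>j::int. q powi (j\<^sup>2) * c) summable_on UNIV" for c
    by (rule summable_on_cmult_left[OF summ])
  have term_le: "norm (q powi (j\<^sup>2) * \<bar>qratio q N j - 1 / P\<bar>) \<le> q powi (j\<^sup>2) * (1 / P\<^sup>2 + 1 / P)" for N and j :: int
    using qr_bound q by (auto simp: abs_mult intro!: mult_left_mono)
  have "e \<longlonglongrightarrow> (\<Sum>\<^sub>\<infinity>j::int. 0)"
    unfolding e_def[abs_def]
  proof (rule tannery_infsum[OF _ term_le summ_c])
    fix j :: int
    have "(\<lambda>N. q powi (j\<^sup>2) * \<bar>qratio q N j - 1 / P\<bar>) \<longlonglongrightarrow> q powi (j\<^sup>2) * \<bar>1 / P - 1 / P\<bar>"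
      by (intro tendsto_intros qr_lim)
    then show "(\<lambda>N. q powi (j\<^sup>2) * \<bar>qratio q N j - 1 / P\<bar>) \<longlonglongrightarrow> 0" by simp
  qed
  then have e0: "e \<longlonglongrightarrow> 0" by simp
  show thesis
  proof (rule that)
    \<comment> \<open>By the triple product, P R^2 is the value of theta at \<pi>/2, its minimum on
      the real line.\<close>
    show "1 / (P * R\<^sup>2) > 0" using P R by simp
    fix d :: "int \<Rightarrow> complex" and B n
    assume bd: "bounded (range d)" and B: "\<And>n. cmod (\<Sum>\<^sub>\<infinity>j. of_real (q powi (j\<^sup>2)) * d (n + j)) \<le> B"
    from bd obtain D where D: "\<And>n. cmod (d n) \<le> D" by (auto simp: bounded_iff)
    have Dnn: "D \<ge> 0" using D norm_ge_zero order_trans by blast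
    have main: "cmod (d n) * (qodd q N)\<^sup>2 \<le> B / P + e N * D" for N
    proof -
      define F where "F m = (\<Sum>j\<in>{-int N..int N}. of_real (q powi (j\<^sup>2) * qratio q N j) * d (m + j))" for m
      have F: "cmod (F m) \<le> B / P + e N * D" for m
      proof -
        have hs1: "((\<lambda>j. of_real (q powi (j\<^sup>2) * qratio q N j) * d (m + j)) has_sum F m) UNIV"
          unfolding F_def by (rule has_sum_finite_neutralI) (auto simp: qratio_def)
        have "(\<lambda>j. norm (of_real (q powi (j\<^sup>2)) * d (m + j))) summable_on UNIV"
          by (rule Infinite_Sum.abs_summable_on_comparison_test'[OF summ_c[of D]])
            (use q D in \<open>auto simp: norm_mult norm_power_int intro!: mult_left_mono\<close>)
        then have "(\<lambda>j. of_real (q powi (j\<^sup>2)) * d (m + j)) summable_on UNIV"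
          by (rule abs_summable_summable)
        then have hs2: "((\<lambda>j. of_real (1 / P) * (of_real (q powi (j\<^sup>2)) * d (m + j))) has_sum
            of_real (1 / P) * (\<Sum>\<^sub>\<infinity>j. of_real (q powi (j\<^sup>2)) * d (m + j))) UNIV" (is "(_ has_sum ?Q) _")
          by (intro has_sum_cmult_right has_sum_infsum)
        have hs3: "((\<lambda>j. of_real (q powi (j\<^sup>2) * (qratio q N j - 1 / P)) * d (m + j)) has_sum F m - ?Q) UNIV"
          using has_sum_add[OF hs1 has_sum_uminusI[OF hs2]] by (simp add: algebra_simps)
        have esum: "((\<lambda>j. q powi (j\<^sup>2) * \<bar>qratio q N j - 1 / P\<bar> * D) has_sum (e N * D)) UNIV"
          unfolding e_def
        proof (intro has_sum_cmult_left has_sum_infsum)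
          show "(\<lambda>j::int. q powi (j\<^sup>2) * \<bar>qratio q N j - 1 / P\<bar>) summable_on UNIV"
            using abs_summable_summable[OF Infinite_Sum.abs_summable_on_comparison_test'[OF summ_c term_le]] by simp
        qed
        have "cmod (F m - ?Q) \<le> e N * D"
        proof (rule norm_infsum_le[OF hs3 esum])
          fix j :: int
          have "norm (complex_of_real (q powi (j\<^sup>2) * (qratio q N j - 1 / P))) = q powi (j\<^sup>2) * \<bar>qratio q N j - 1 / P\<bar>"
            unfolding norm_of_real abs_mult using q by simp
          then show "norm (of_real (q powi (j\<^sup>2) * (qratio q N j - 1 / P)) * d (m + j))
              \<le> q powi (j\<^sup>2) * \<bar>qratio q N j - 1 / P\<bar> * D"
            unfolding norm_mult using q D[of "m + j"] by (simp add: mult_left_mono)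
        qed
        moreover have "cmod ?Q \<le> B / P" using B[of m] P by (simp add: norm_mult norm_divide divide_right_mono)
        ultimately show ?thesis using norm_triangle_sub[of "F m" ?Q] by linarith
      qed
      let ?y = "q / q ^ (2 * N)"
      have "cmod (qsum q ?y (2 * N) d m) \<le> (B / P + e N * D) / q ^ (N * N)" for m
      proof -
        have "q ^ (N * N) * cmod (qsum q ?y (2 * N) d m) = cmod (F (m + int N))"
          unfolding F_def qsum_eq_qratio[OF q, symmetric] using q by (simp add: norm_mult norm_power)
        then show ?thesis using F[of "m + int N"] q by (simp add: field_simps)
      qed
      then have "cmod (d n) * (\<Prod>j<2 * N. \<bar>1 - ?y * q ^ (2 * j)\<bar>) \<le> (B / P + e N * D) / q ^ (N * N)"
        by (intro qsum_lower_bound) (use bd q in auto)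
      then have "cmod (d n) * ((\<Prod>j<2 * N. \<bar>1 - ?y * q ^ (2 * j)\<bar>) * q ^ (N * N)) \<le> B / P + e N * D"
        using q by (simp add: field_simps)
      then show ?thesis by (simp only: prod_odd_eq[OF q])
    qed
    have "(\<lambda>N. cmod (d n) * (qodd q N)\<^sup>2) \<longlonglongrightarrow> cmod (d n) * R\<^sup>2" by (intro tendsto_intros R)
    moreover have "(\<lambda>N. B / P + e N * D) \<longlonglongrightarrow> B / P + 0 * D" by (intro tendsto_intros e0)
    ultimately have "cmod (d n) * R\<^sup>2 \<le> B / P + 0 * D" using main by (intro LIMSEQ_le) auto
    then show "cmod (d n) \<le> 1 / (P * R\<^sup>2) * B" using P R by (simp add: field_simps)
  qed
qed

section \<open>Gaussian Fourier transforms and products of series\<close>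

lemma gauss_fourier_centered:
  fixes s \<omega> :: real
  assumes "s > 0"
  shows "has_bochner_integral lborel (\<lambda>t. of_real (exp (- s * t\<^sup>2)) * exp (\<i> * of_real (\<omega> * t)))
    (of_real (sqrt (pi / s) * exp (- \<omega>\<^sup>2 / (4 * s))) :: complex)"
proof -
  \<comment> \<open>With this scaling the Gaussian becomes a multiple of the standard normal
    density, whose characteristic function is available.\<close>
  define c where "c = 1 / sqrt (2 * s)"
  have c: "c > 0" "c\<^sup>2 = 1 / (2 * s)" using assms by (auto simp: c_def power_divide)
  let ?f = "\<lambda>t. of_real (exp (- s * t\<^sup>2)) * exp (\<i> * of_real (\<omega> * t)) :: complex"
  have fc: "?f (0 + c * x) = of_real (sqrt (2 * pi)) * (std_normal_density x *\<^sub>R iexp (\<omega> * c * x))" for x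
  proof -
    have "- s * (c * x)\<^sup>2 = - x\<^sup>2 / 2" using assms by (simp add: power_mult_distrib c)
    then show ?thesis by (simp only: add_0 std_normal_density_def scaleR_conv_of_real of_real_mult mult.assoc) (simp add: mult.assoc)
  qed
  have int_norm: "integrable lborel (\<lambda>x. std_normal_density x *\<^sub>R iexp (\<omega> * c * x))"
  proof (rule Bochner_Integration.integrable_bound[OF integrable_std_normal_moment[of 0]])
    show "AE x in lborel. norm (std_normal_density x *\<^sub>R iexp (\<omega> * c * x)) \<le> norm (std_normal_density x * x ^ 0)"
      by simp
  qed simp
  have "char std_normal_distribution (\<omega> * c) = (\<integral>x. std_normal_density x *\<^sub>R iexp (\<omega> * c * x) \<partial>lborel)"
    unfolding char_def by (subst integral_density) auto
  then have I: "(\<integral>x. std_normal_density x *\<^sub>R iexp (\<omega> * c * x) \<partial>lborel) = of_real (exp (- (\<omega> * c)\<^sup>2 / 2))"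
    by (simp add: char_std_normal_distribution)
  have int: "integrable lborel (\<lambda>x. ?f (0 + c * x))"
    unfolding fc using int_norm by (rule integrable_mult_right)
  then have 1: "integrable lborel ?f"
    using lborel_integrable_real_affine_iff[of c ?f 0] c by simp
  have "integral\<^sup>L lborel ?f = \<bar>c\<bar> *\<^sub>R (\<integral>x. ?f (0 + c * x) \<partial>lborel)"
    by (rule lborel_integral_real_affine) (use c in auto)
  also have "\<dots> = of_real (c * sqrt (2 * pi) * exp (- (\<omega> * c)\<^sup>2 / 2))"
    unfolding fc using c I by (simp add: scaleR_conv_of_real)
  also have "c * sqrt (2 * pi) = sqrt (pi / s)"
    using assms by (simp add: c_def real_sqrt_mult real_sqrt_divide)
  also have "- (\<omega> * c)\<^sup>2 / 2 = - \<omega>\<^sup>2 / (4 * s)"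
    by (simp add: power_mult_distrib c)
  finally show ?thesis using 1 by (simp add: has_bochner_integral_iff)
qed

lemma gauss_fourier:
  fixes s \<omega> \<mu> :: real
  assumes "s > 0"
  shows "has_bochner_integral lborel (\<lambda>t. of_real (exp (- s * (t - \<mu>)\<^sup>2)) * exp (\<i> * of_real (\<omega> * t)))
    (of_real (sqrt (pi / s) * exp (- \<omega>\<^sup>2 / (4 * s))) * exp (\<i> * of_real (\<omega> * \<mu>)) :: complex)"
proof -
  let ?g = "\<lambda>t. of_real (exp (- s * (t - \<mu>)\<^sup>2)) * exp (\<i> * of_real (\<omega> * t)) :: complex"
  have "?g (\<mu> + 1 * t) = of_real (exp (- s * t\<^sup>2)) * exp (\<i> * of_real (\<omega> * t)) * exp (\<i> * of_real (\<omega> * \<mu>))" for t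
    by (simp add: algebra_simps flip: exp_add)
  then show ?thesis
    using has_bochner_integral_mult_left[OF gauss_fourier_centered[OF assms, of \<omega>], of "exp (\<i> * of_real (\<omega> * \<mu>))"]
    by (subst lborel_has_bochner_integral_real_affine_iff[of 1 _ _ \<mu>]) (simp_all add: mult.assoc)
qed

lemma gauss_integral:
  fixes s \<mu> :: real
  assumes "s > 0"
  shows "has_bochner_integral lborel (\<lambda>t. exp (- s * (t - \<mu>)\<^sup>2)) (sqrt (pi / s))"
proof -
  have "has_bochner_integral lborel (\<lambda>t. complex_of_real (exp (- s * (t - \<mu>)\<^sup>2))) (of_real (sqrt (pi / s)))"
    using gauss_fourier[OF assms, of \<mu> 0] by simp
  then show ?thesis by (simp only: has_bochner_integral_iff integral_complex_of_real complex_of_real_integrable_eq of_real_eq_iff)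
qed

lemma has_sum_times:
  fixes a :: "'i \<Rightarrow> complex" and b :: "'j \<Rightarrow> complex"
  assumes a: "(a has_sum S) UNIV" "(\<lambda>i. norm (a i)) summable_on UNIV"
    and b: "(b has_sum T) UNIV" "(\<lambda>j. norm (b j)) summable_on UNIV"
  shows "((\<lambda>(i, j). a i * b j) has_sum S * T) UNIV" "(\<lambda>(i, j). norm (a i * b j)) summable_on UNIV"
proof -
  have "((\<lambda>j. norm (a i * b j)) has_sum norm (a i) * (\<Sum>\<^sub>\<infinity>j. norm (b j))) UNIV" for i
    unfolding norm_mult using b(2) by (intro has_sum_cmult_right has_sum_infsum)
  then have "(\<lambda>(i, j). norm (a i * b j)) summable_on (UNIV \<times> UNIV)"
    by (intro summable_on_SigmaI[where g = "\<lambda>i. norm (a i) * (\<Sum>\<^sub>\<infinity>j. norm (b j))"] summable_on_cmult_left a(2)) auto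
  then show 1: "(\<lambda>(i, j). norm (a i * b j)) summable_on UNIV" by simp
  then have "(\<lambda>(i, j). a i * b j) summable_on UNIV"
    using abs_summable_summable[of "\<lambda>(i, j). a i * b j" UNIV] by (simp add: case_prod_unfold)
  then have hs: "((\<lambda>(i, j). a i * b j) has_sum (\<Sum>\<^sub>\<infinity>(i, j). a i * b j)) (UNIV \<times> UNIV)" by simp
  have "((\<lambda>i. a i * T) has_sum (\<Sum>\<^sub>\<infinity>(i, j). a i * b j)) UNIV"
    by (rule has_sum_SigmaD[OF hs]) (auto intro: has_sum_cmult_right b)
  moreover have "((\<lambda>i. a i * T) has_sum S * T) UNIV" by (rule has_sum_cmult_left[OF a(1)])
  ultimately show "((\<lambda>(i, j). a i * b j) has_sum S * T) UNIV" using hs has_sum_unique by fastforce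
qed

lemma has_sum_antidiagonals:
  fixes T :: "int \<Rightarrow> int \<Rightarrow> complex"
  assumes T: "((\<lambda>(k, l). T k l) has_sum S) UNIV"
    and inner: "\<And>m. ((\<lambda>k. T k (m - k)) has_sum g m) UNIV"
  shows "(g has_sum S) UNIV"
proof (rule has_sum_SigmaD)
  show "((\<lambda>(m, k). T k (m - k)) has_sum S) (UNIV \<times> UNIV)"
    by (subst has_sum_reindex_bij_witness[of "UNIV \<times> UNIV" "\<lambda>(k, l). (k + l, k)" "\<lambda>(m, k). (k, m - k)" UNIV "\<lambda>(k, l). T k l" _ S S])
      (use T in auto)
qed (use inner in auto)

text \<open>The product of the generators \<phi>(s + u/2 - \<beta> k) and \<phi>(s - u/2 - \<beta>
  l) splits into a Gaussian in s centred at \<beta> (k + l) / 2 and a factor that depends only on j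
  = k - l and u. This is the latter factor.\<close>

definition diag_weight :: "real \<Rightarrow> real \<Rightarrow> real \<Rightarrow> int \<Rightarrow> real" where
  "diag_weight \<sigma> \<beta> u j = exp (- (1 / \<sigma>\<^sup>2) * (\<beta> * of_int j / 2 - u / 2)\<^sup>2)"

text \<open>Coefficients, in the space with step \<beta> / 2, of f (s + u/2) cnj (f (s - u/2)) as a
  function of s. The sum runs over an antidiagonal k + l = m, on which k - l = 2 k - m.\<close>

definition diag_coeff :: "real \<Rightarrow> real \<Rightarrow> real \<Rightarrow> (int \<Rightarrow> complex) \<Rightarrow> int \<Rightarrow> complex" where
  "diag_coeff \<sigma> \<beta> u c m = (\<Sum>\<^sub>\<infinity>k. c k * cnj (c (m - k)) * of_real (diag_weight \<sigma> \<beta> u (2 * k - m)))"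

text \<open>On an antidiagonal the weights are samples of one Gaussian with step \<beta>, at an
  offset depending on m. The bound in \<open>gauss_sum_bound\<close> is uniform in the offset, hence
  the coefficients are bounded in m.\<close>

lemma diag_coeff:
  assumes \<sigma>: "\<sigma> > 0" and \<beta>: "\<beta> > 0" and c: "bounded (range c)"
  shows "bounded (range (diag_coeff \<sigma> \<beta> u c))"
    and "((\<lambda>k. c k * cnj (c (m - k)) * of_real (diag_weight \<sigma> \<beta> u (2 * k - m)))
      has_sum diag_coeff \<sigma> \<beta> u c m) UNIV"
proof -
  from c obtain C where C: "\<And>k. cmod (c k) \<le> C" by (auto simp: bounded_iff)
  have Cnn: "C \<ge> 0" using C norm_ge_zero order_trans by blast
  have "1 / \<sigma>\<^sup>2 > 0" using \<sigma> by simp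
  from gauss_sum_bound[OF this \<beta>] obtain B where
    B: "\<And>x. (\<lambda>k::int. exp (- (1 / \<sigma>\<^sup>2) * (\<beta> * of_int k - x)\<^sup>2)) summable_on UNIV"
       "\<And>x. (\<Sum>\<^sub>\<infinity>k::int. exp (- (1 / \<sigma>\<^sup>2) * (\<beta> * of_int k - x)\<^sup>2)) \<le> B" by blast
  have w: "diag_weight \<sigma> \<beta> u (2 * k - m) = exp (- (1 / \<sigma>\<^sup>2) * (\<beta> * of_int k - (\<beta> * m / 2 + u / 2))\<^sup>2)" for k m
    
  proof -
    have "\<beta> * of_int (2 * k - m) / 2 - u / 2 = \<beta> * of_int k - (\<beta> * m / 2 + u / 2)" by (simp add: field_simps)
    then show ?thesis by (simp only: diag_weight_def)
  qed
  let ?w = "\<lambda>m k. diag_weight \<sigma> \<beta> u (2 * k - m)"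
  have ws: "((\<lambda>k. C * C * ?w m k) has_sum C * C * infsum (?w m) UNIV) UNIV" for m
    by (intro has_sum_cmult_right has_sum_infsum) (simp only: w B)
  have le: "norm (c k * cnj (c (m - k)) * of_real (?w m k)) \<le> C * C * ?w m k" for m k
    using C Cnn by (auto simp: norm_mult diag_weight_def intro!: mult_right_mono mult_mono)
  show hs: "((\<lambda>k. c k * cnj (c (m - k)) * of_real (?w m k)) has_sum diag_coeff \<sigma> \<beta> u c m) UNIV" for m
    unfolding diag_coeff_def
    by (intro has_sum_infsum, rule abs_summable_summable, rule Infinite_Sum.abs_summable_on_comparison_test'[OF _ le])
      (use ws in \<open>auto simp: summable_on_def\<close>)
  have "norm (diag_coeff \<sigma> \<beta> u c m) \<le> C * C * B" for m
  proof -
    have "norm (diag_coeff \<sigma> \<beta> u c m) \<le> C * C * infsum (?w m) UNIV"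
      by (rule norm_infsum_le[OF hs ws le])
    also have "\<dots> \<le> C * C * B"
      by (intro mult_left_mono) (simp_all only: w B, simp)
    finally show ?thesis .
  qed
  then show "bounded (range (diag_coeff \<sigma> \<beta> u c))" by (auto simp: bounded_iff)
qed

text \<open>Serves both the spectrogram and the pointwise product: their double series contain k - l
  through the same weight and differ only in W. The two expansions therefore share their
  coefficients, which is what allows passing from one to the other.\<close>

lemma has_sum_diag_coeff:
  assumes \<sigma>: "\<sigma> > 0" and \<beta>: "\<beta> > 0" and c: "bounded (range c)"
    and T: "((\<lambda>(k, l). c k * cnj (c l) * of_real (diag_weight \<sigma> \<beta> u (k - l)) * W (k + l)) has_sum S) UNIV"
  shows "((\<lambda>m. diag_coeff \<sigma> \<beta> u c m * W m) has_sum S) UNIV"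
proof (rule has_sum_antidiagonals[OF T])
  fix m
  have "k - (m - k) = 2 * k - m" for k :: int by simp
  then show "((\<lambda>k. c k * cnj (c (m - k)) * of_real (diag_weight \<sigma> \<beta> u (k - (m - k))) * W (k + (m - k)))
      has_sum diag_coeff \<sigma> \<beta> u c m * W m) UNIV"
    using has_sum_cmult_left[OF diag_coeff(2)[OF \<sigma> \<beta> c, of m u], of "W m"] by simp
qed

section \<open>The Gabor transform on the Gaussian shift-invariant space\<close>

definition gabor :: "real \<Rightarrow> (real \<Rightarrow> complex) \<Rightarrow> real \<Rightarrow> real \<Rightarrow> complex" where
  "gabor \<sigma> f x \<eta> = (\<integral>t. f t * gauss \<sigma> (t - x) * exp (\<i> * of_real (- 2 * pi * \<eta> * t)) \<partial>lborel)"

lemma summable_gauss: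
  assumes "\<sigma> > 0" "\<beta> > 0" "bounded (range c)"
  shows "(\<lambda>k. norm (c k * gauss \<sigma> (t - \<beta> * of_int k))) summable_on UNIV"
proof -
  from assms obtain C where C: "\<And>k. cmod (c k) \<le> C" by (auto simp: bounded_iff)
  have "1 / (2 * \<sigma>\<^sup>2) > 0" using assms by simp
  from gauss_sum_bound[OF this assms(2)]
  have S: "(\<lambda>k::int. exp (- (1 / (2 * \<sigma>\<^sup>2)) * (\<beta> * of_int k - t)\<^sup>2)) summable_on UNIV" by blast
  show ?thesis
  proof (rule Infinite_Sum.abs_summable_on_comparison_test'[OF summable_on_cmult_right[OF S, of C]])
    show "norm (c k * gauss \<sigma> (t - \<beta> * of_int k)) \<le> C * exp (- (1 / (2 * \<sigma>\<^sup>2)) * (\<beta> * of_int k - t)\<^sup>2)" for k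
      using C[of k] by (simp add: norm_mult gauss_def power2_commute mult_right_mono)
  qed
qed

text \<open>Continuity links the values at the points p_j with \<open>Linf_norm\<close>, an
  essential supremum. The M-test is applied on bounded intervals because the majorant used grows
  with R.\<close>

lemma gauss_SIS_continuous:
  assumes "\<sigma> > 0" "\<beta> > 0" "f \<in> gauss_SIS \<sigma> \<beta>"
  shows "continuous_on UNIV f"
proof -
  from assms obtain c where c: "bounded (range c)"
    "\<And>t. ((\<lambda>k. c k * gauss \<sigma> (t - \<beta> * of_int k)) has_sum f t) UNIV"
    unfolding gauss_SIS_def by auto
  from c(1) obtain C where C: "\<And>k. cmod (c k) \<le> C" by (auto simp: bounded_iff)
  have Cnn: "C \<ge> 0" using C norm_ge_zero order_trans by blast
  define q where "q = exp (- (\<beta>\<^sup>2 / (4 * \<sigma>\<^sup>2)))"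
  have q: "0 < q" "q < 1" using assms by (auto simp: q_def)
  have "continuous_on {-R<..<R} f" for R :: real
  proof (rule uniform_limit_theorem)
    show "uniform_limit {-R<..<R} (\<lambda>X t. \<Sum>k\<in>X. c k * gauss \<sigma> (t - \<beta> * of_int k)) f (finite_subsets_at_top UNIV)"
    proof (rule Weierstrass_m_test_general')
      show "(\<lambda>k::int. C * exp (R\<^sup>2 / (2 * \<sigma>\<^sup>2)) * q powi (k\<^sup>2)) summable_on UNIV"
        by (intro summable_on_cmult_right summable_powi_square q)
      fix k :: int and t :: real assume t: "t \<in> {-R<..<R}"
      have "t\<^sup>2 \<le> R\<^sup>2" using t by (intro power2_le_iff_abs_le[THEN iffD2]) auto
      \<comment> \<open>Half of this square is (t - \<beta> k)^2 - (\<beta>^2 k^2 / 2 -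
        t^2).\<close>
      moreover have "0 \<le> (2 * t - \<beta> * of_int k)\<^sup>2" by simp
      ultimately have "\<beta>\<^sup>2 * (of_int k)\<^sup>2 / 2 - R\<^sup>2 \<le> (t - \<beta> * of_int k)\<^sup>2"
        by (simp add: power2_eq_square algebra_simps)
      then have "(\<beta>\<^sup>2 * (of_int k)\<^sup>2 / 2 - R\<^sup>2) / (2 * \<sigma>\<^sup>2) \<le> (t - \<beta> * of_int k)\<^sup>2 / (2 * \<sigma>\<^sup>2)"
        by (intro divide_right_mono) auto
      moreover have "(\<beta>\<^sup>2 * (of_int k)\<^sup>2 / 2 - R\<^sup>2) / (2 * \<sigma>\<^sup>2) = of_int (k\<^sup>2) * (\<beta>\<^sup>2 / (4 * \<sigma>\<^sup>2)) - R\<^sup>2 / (2 * \<sigma>\<^sup>2)"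
        using assms by (simp add: field_simps)
      ultimately have "- (t - \<beta> * of_int k)\<^sup>2 / (2 * \<sigma>\<^sup>2) \<le> R\<^sup>2 / (2 * \<sigma>\<^sup>2) + of_int (k\<^sup>2) * (- (\<beta>\<^sup>2 / (4 * \<sigma>\<^sup>2)))"
        by linarith
      then have "exp (- (t - \<beta> * of_int k)\<^sup>2 / (2 * \<sigma>\<^sup>2)) \<le> exp (R\<^sup>2 / (2 * \<sigma>\<^sup>2)) * q powi (k\<^sup>2)"
        unfolding q_def exp_power_int exp_add[symmetric] by simp
      then show "norm (c k * gauss \<sigma> (t - \<beta> * of_int k)) \<le> C * exp (R\<^sup>2 / (2 * \<sigma>\<^sup>2)) * q powi (k\<^sup>2)"
        unfolding norm_mult gauss_def norm_of_real abs_exp_cancel mult.assoc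
        using C[of k] Cnn by (intro mult_mono) auto
    qed (use c in auto)
    show "\<forall>\<^sub>F X in finite_subsets_at_top UNIV. continuous_on {-R<..<R} (\<lambda>t. \<Sum>k\<in>X. c k * gauss \<sigma> (t - \<beta> * of_int k))"
      unfolding gauss_def using assms by (intro always_eventually allI continuous_intros) auto
  qed auto
  then have "continuous_on (\<Union>n::nat. {- real n<..<real n}) f"
    by (intro continuous_on_open_UN) auto
  moreover have "(\<Union>n::nat. {- real n<..<real n}) = UNIV"
  proof -
    have "x \<in> (\<Union>n::nat. {- real n<..<real n})" for x
      using reals_Archimedean2[of "\<bar>x\<bar>"] by (auto simp: abs_less_iff) (metis minus_less_iff)
    then show ?thesis by auto
  qed
  ultimately show ?thesis by simp
qed

text \<open>The Gabor transform at (x, \<eta>) of the single generator \<phi>(t - \<beta> k), in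
  closed form.\<close>

definition gabor_term :: "real \<Rightarrow> real \<Rightarrow> real \<Rightarrow> real \<Rightarrow> int \<Rightarrow> complex" where
  "gabor_term \<sigma> \<beta> x \<eta> k = of_real (exp (- (\<beta> * of_int k - x)\<^sup>2 / (4 * \<sigma>\<^sup>2)) * (\<sigma> * sqrt pi * exp (- (pi\<^sup>2 * \<sigma>\<^sup>2) * \<eta>\<^sup>2)))
     * exp (\<i> * of_real (- pi * \<eta> * (\<beta> * of_int k + x)))"

lemma gauss_window_product:
  assumes "\<sigma> > 0"
  shows "gauss \<sigma> (t - y) * gauss \<sigma> (t - x) =
    of_real (exp (- (y - x)\<^sup>2 / (4 * \<sigma>\<^sup>2)) * exp (- (1 / \<sigma>\<^sup>2) * (t - (y + x) / 2)\<^sup>2))"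
proof -
  have "(t - y)\<^sup>2 / 2 + (t - x)\<^sup>2 / 2 = (y - x)\<^sup>2 / 4 + (t - (y + x) / 2)\<^sup>2"
    by (simp add: power2_eq_square field_simps)
  then have "((t - y)\<^sup>2 / 2 + (t - x)\<^sup>2 / 2) / \<sigma>\<^sup>2 = ((y - x)\<^sup>2 / 4 + (t - (y + x) / 2)\<^sup>2) / \<sigma>\<^sup>2"
    by simp
  then have "- (t - y)\<^sup>2 / (2 * \<sigma>\<^sup>2) + - (t - x)\<^sup>2 / (2 * \<sigma>\<^sup>2) = - (y - x)\<^sup>2 / (4 * \<sigma>\<^sup>2) + - (1 / \<sigma>\<^sup>2) * (t - (y + x) / 2)\<^sup>2"
    using assms by (simp add: add_divide_distrib)
  then show ?thesis
    unfolding gauss_def of_real_mult[symmetric] exp_add[symmetric] by simp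
qed

lemma gabor_expansion:
  assumes \<sigma>: "\<sigma> > 0" and \<beta>: "\<beta> > 0" and c: "bounded (range c)"
    and f: "\<And>t. ((\<lambda>k. c k * gauss \<sigma> (t - \<beta> * of_int k)) has_sum f t) UNIV"
  shows "((\<lambda>k. c k * gabor_term \<sigma> \<beta> x \<eta> k) has_sum gabor \<sigma> f x \<eta>) UNIV"
    and "(\<lambda>k. norm (c k * gabor_term \<sigma> \<beta> x \<eta> k)) summable_on UNIV"
proof -
  from c obtain C where C: "\<And>k. cmod (c k) \<le> C" by (auto simp: bounded_iff)
  let ?E = "\<lambda>k::int. exp (- (\<beta> * of_int k - x)\<^sup>2 / (4 * \<sigma>\<^sup>2))"
  have "1 / (4 * \<sigma>\<^sup>2) > 0" using \<sigma> by simp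
  from gauss_sum_bound[OF this \<beta>]
  have "(\<lambda>k::int. exp (- (1 / (4 * \<sigma>\<^sup>2)) * (\<beta> * of_int k - x)\<^sup>2)) summable_on UNIV" by blast
  then have S: "(\<lambda>k. ?E k) summable_on UNIV" by simp
  have s: "1 / \<sigma>\<^sup>2 > 0" and sq: "sqrt (pi / (1 / \<sigma>\<^sup>2)) = \<sigma> * sqrt pi"
    using \<sigma> by (simp_all add: real_sqrt_mult)
  let ?h = "\<lambda>k t. c k * gauss \<sigma> (t - \<beta> * of_int k) * gauss \<sigma> (t - x) * exp (\<i> * of_real (- 2 * pi * \<eta> * t))"
  have h: "?h k t = c k * of_real (?E k) * (of_real (exp (- (1 / \<sigma>\<^sup>2) * (t - (\<beta> * of_int k + x) / 2)\<^sup>2)) * exp (\<i> * of_real (- 2 * pi * \<eta> * t)))" for k t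
    using gauss_window_product[OF \<sigma>, of t "\<beta> * of_int k" x] by (simp add: mult.assoc)
  have int: "has_bochner_integral lborel (?h k) (c k * gabor_term \<sigma> \<beta> x \<eta> k)" for k
  proof -
    have e: "- (- 2 * pi * \<eta>)\<^sup>2 / (4 * (1 / \<sigma>\<^sup>2)) = - (pi\<^sup>2 * \<sigma>\<^sup>2) * \<eta>\<^sup>2" using \<sigma> by (simp add: field_simps)
    have "- 2 * pi * \<eta> * ((\<beta> * of_int k + x) / 2) = - pi * \<eta> * (\<beta> * of_int k + x)" by simp
    then have "c k * of_real (?E k) * (of_real (sqrt (pi / (1 / \<sigma>\<^sup>2)) * exp (- (- 2 * pi * \<eta>)\<^sup>2 / (4 * (1 / \<sigma>\<^sup>2)))) * exp (\<i> * of_real (- 2 * pi * \<eta> * ((\<beta> * of_int k + x) / 2))))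
      = c k * gabor_term \<sigma> \<beta> x \<eta> k"
      unfolding gabor_term_def sq e by (simp only: of_real_mult mult.assoc)
    moreover have "has_bochner_integral lborel (?h k) (c k * of_real (?E k) * (of_real (sqrt (pi / (1 / \<sigma>\<^sup>2)) * exp (- (- 2 * pi * \<eta>)\<^sup>2 / (4 * (1 / \<sigma>\<^sup>2)))) * exp (\<i> * of_real (- 2 * pi * \<eta> * ((\<beta> * of_int k + x) / 2)))))"
      unfolding h by (intro has_bochner_integral_mult_right gauss_fourier s)
    ultimately show ?thesis by (simp only:)
  qed
  have bnd: "(\<integral>t. norm (?h k t) \<partial>lborel) \<le> C * ?E k * (\<sigma> * sqrt pi)" for k
  proof -
    have "(\<integral>t. norm (?h k t) \<partial>lborel) = (\<integral>t. (cmod (c k) * ?E k) * exp (- (1 / \<sigma>\<^sup>2) * (t - (\<beta> * of_int k + x) / 2)\<^sup>2) \<partial>lborel)"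
      unfolding h by (simp add: norm_mult)
    also have "\<dots> = cmod (c k) * ?E k * (\<sigma> * sqrt pi)"
      using has_bochner_integral_integral_eq[OF gauss_integral[OF s, of "(\<beta> * of_int k + x) / 2"]] sq by simp
    also have "\<dots> \<le> C * ?E k * (\<sigma> * sqrt pi)"
      using C[of k] \<sigma> by (intro mult_right_mono) auto
    finally show ?thesis .
  qed
  have Bs: "(\<lambda>k. C * ?E k * (\<sigma> * sqrt pi)) summable_on UNIV"
    by (intro summable_on_cmult_left summable_on_cmult_right S)
  have "((\<lambda>k. c k * gabor_term \<sigma> \<beta> x \<eta> k) has_sum (\<integral>t. f t * gauss \<sigma> (t - x) * exp (\<i> * of_real (- 2 * pi * \<eta> * t)) \<partial>lborel)) UNIV"
  proof (rule has_bochner_integral_has_sum(2)[OF _ int bnd Bs])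
    fix t
    show "((\<lambda>k. ?h k t) has_sum f t * gauss \<sigma> (t - x) * exp (\<i> * of_real (- 2 * pi * \<eta> * t))) UNIV"
      by (intro has_sum_cmult_left f)
    show "(\<lambda>k. norm (?h k t)) summable_on UNIV"
      unfolding norm_mult[of _ "exp _"] norm_mult[of _ "gauss \<sigma> (t - x)"]
      by (intro summable_on_cmult_left summable_gauss \<sigma> \<beta> c)
  qed auto
  then show "((\<lambda>k. c k * gabor_term \<sigma> \<beta> x \<eta> k) has_sum gabor \<sigma> f x \<eta>) UNIV"
    unfolding gabor_def .
  show "(\<lambda>k. norm (c k * gabor_term \<sigma> \<beta> x \<eta> k)) summable_on UNIV"
  proof (rule Infinite_Sum.abs_summable_on_comparison_test'[OF Bs])
    fix k
    have "norm (gabor_term \<sigma> \<beta> x \<eta> k) = ?E k * (\<sigma> * sqrt pi) * exp (- (pi\<^sup>2 * \<sigma>\<^sup>2) * \<eta>\<^sup>2)"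
      using \<sigma> by (simp add: gabor_term_def norm_mult)
    also have "\<dots> \<le> ?E k * (\<sigma> * sqrt pi)" using \<sigma> by (intro mult_left_le) auto
    finally show "norm (c k * gabor_term \<sigma> \<beta> x \<eta> k) \<le> C * ?E k * (\<sigma> * sqrt pi)"
      unfolding norm_mult mult.assoc using C[of k] order_trans[OF norm_ge_zero C[of k]] by (intro mult_mono) auto
  qed
qed

text \<open>After division by \<sigma>^2, the left side collects the window factors of k and l and
  the Fourier transform at lag u. On the right stand the exponents of \<open>diag_weight\<close>, of
  the nome q with its \<beta>^2 / 8, and of the factor exp (u^2 / (4 \<sigma>^2)) in the final
  constant.\<close>

lemma autocorrelation_exponent:
  fixes \<beta> u :: real and k l n :: int
  shows "(\<beta> * of_int k - \<beta> / 2 * of_int n)\<^sup>2 / 4 + (\<beta> * of_int l - \<beta> / 2 * of_int n)\<^sup>2 / 4 + (u - \<beta> * of_int (k - l) / 2)\<^sup>2 / 2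
    = (\<beta> * of_int (k - l) / 2 - u / 2)\<^sup>2 + of_int ((k + l - n)\<^sup>2) * (\<beta>\<^sup>2 / 8) + u\<^sup>2 / 4"
  by (simp add: power2_eq_square field_simps)

text \<open>Multiplying the Gabor series by its conjugate gives a double series of modulated
  Gaussians in \<eta>, which is integrated term by term; the norms of the terms have integrals
  dominated by a summable product in k and l.\<close>

lemma gabor_autocorrelation:
  fixes n :: int and u \<sigma> \<beta> :: real and f :: "real \<Rightarrow> complex" and c :: "int \<Rightarrow> complex"
  assumes \<sigma>: "\<sigma> > 0" and \<beta>: "\<beta> > 0" and c: "bounded (range c)"
    and f: "\<And>t. ((\<lambda>k. c k * gauss \<sigma> (t - \<beta> * of_int k)) has_sum f t) UNIV"
  defines "q \<equiv> exp (- \<beta>\<^sup>2 / (8 * \<sigma>\<^sup>2))"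
  defines "F \<equiv> \<lambda>\<eta>. of_real ((cmod (gabor \<sigma> f (\<beta> / 2 * of_int n) \<eta>))\<^sup>2) * exp (\<i> * of_real (2 * pi * u * \<eta>))"
  shows "integrable lborel F"
    and "((\<lambda>m. diag_coeff \<sigma> \<beta> u c m * of_real (q powi ((m - n)\<^sup>2))) has_sum
      of_real (exp (u\<^sup>2 / (4 * \<sigma>\<^sup>2)) / (\<sigma> * sqrt (pi / 2))) * integral\<^sup>L lborel F) UNIV"
proof -
  from c obtain C where C: "\<And>k. cmod (c k) \<le> C" by (auto simp: bounded_iff)
  have Cnn: "C \<ge> 0" using C norm_ge_zero order_trans by blast
  let ?x = "\<beta> / 2 * of_int n"
  let ?E = "\<lambda>k::int. exp (- (\<beta> * of_int k - ?x)\<^sup>2 / (4 * \<sigma>\<^sup>2))"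
  let ?V = "\<lambda>\<eta>. gabor \<sigma> f ?x \<eta>"
  let ?t = "\<lambda>\<eta> k. c k * gabor_term \<sigma> \<beta> ?x \<eta> k"
  let ?s = "2 * pi\<^sup>2 * \<sigma>\<^sup>2"
  note V = gabor_expansion[OF \<sigma> \<beta> c f, of ?x]
  have V': "((\<lambda>k. cnj (?t \<eta> k)) has_sum cnj (?V \<eta>)) UNIV" "(\<lambda>k. norm (cnj (?t \<eta> k))) summable_on UNIV" for \<eta>
    using V[of \<eta>] by (simp_all only: has_sum_cnj_iff complex_mod_cnj)
  define h where "h = (\<lambda>(k, l) \<eta>. ?t \<eta> k * cnj (?t \<eta> l) * exp (\<i> * of_real (2 * pi * u * \<eta>)))"
  have "1 / (4 * \<sigma>\<^sup>2) > 0" using \<sigma> by simp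
  from gauss_sum_bound[OF this \<beta>]
  have "(\<lambda>k::int. exp (- (1 / (4 * \<sigma>\<^sup>2)) * (\<beta> * of_int k - ?x)\<^sup>2)) summable_on UNIV" by blast
  then have S: "(\<lambda>k. ?E k) summable_on UNIV" by simp
  have s: "?s > 0" using \<sigma> by simp
  have sq: "sqrt (pi / ?s) = 1 / (\<sigma> * sqrt (2 * pi))"
    using \<sigma> by (simp add: real_sqrt_mult real_sqrt_divide power2_eq_square)
  \<comment> \<open>The modulations of the k-th and l-th terms and of the lag merge into one, of
    frequency 2 \<pi> (u - \<beta> (k - l) / 2), so only a single Gaussian Fourier transform
    remains.\<close>
  have h: "h (k, l) \<eta> = c k * cnj (c l) * of_real (?E k * ?E l * (pi * \<sigma>\<^sup>2)) *
      (of_real (exp (- ?s * (\<eta> - 0)\<^sup>2)) * exp (\<i> * of_real ((2 * pi * u - pi * \<beta> * of_int (k - l)) * \<eta>)))" for k l \<eta>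
  proof -
    have e1: "exp (\<i> * of_real (- pi * \<eta> * (\<beta> * of_int k + ?x))) * cnj (exp (\<i> * of_real (- pi * \<eta> * (\<beta> * of_int l + ?x)))) * exp (\<i> * of_real (2 * pi * u * \<eta>))
      = exp (\<i> * of_real ((2 * pi * u - pi * \<beta> * of_int (k - l)) * \<eta>))"
    proof -
      have *: "cnj (exp (\<i> * of_real y)) = exp (\<i> * of_real (- y))" for y by (simp add: exp_cnj)
      show ?thesis
        unfolding * exp_add[symmetric] by (simp add: algebra_simps)
    qed
    have "exp (- (pi\<^sup>2 * \<sigma>\<^sup>2) * \<eta>\<^sup>2) * exp (- (pi\<^sup>2 * \<sigma>\<^sup>2) * \<eta>\<^sup>2) = exp (- ?s * (\<eta> - 0)\<^sup>2)"
      by (simp flip: exp_add)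
    moreover have "sqrt pi * sqrt pi = pi" by simp
    moreover have "(\<sigma> * y * z) * (\<sigma> * y * z) = (y * y) * \<sigma>\<^sup>2 * (z * z)" for y z :: real
      by (simp add: power2_eq_square)
    ultimately have e2: "(\<sigma> * sqrt pi * exp (- (pi\<^sup>2 * \<sigma>\<^sup>2) * \<eta>\<^sup>2)) * (\<sigma> * sqrt pi * exp (- (pi\<^sup>2 * \<sigma>\<^sup>2) * \<eta>\<^sup>2)) = pi * \<sigma>\<^sup>2 * exp (- ?s * (\<eta> - 0)\<^sup>2)"
      by metis
    have "h (k, l) \<eta> = c k * cnj (c l) * of_real (?E k * ?E l * ((\<sigma> * sqrt pi * exp (- (pi\<^sup>2 * \<sigma>\<^sup>2) * \<eta>\<^sup>2)) * (\<sigma> * sqrt pi * exp (- (pi\<^sup>2 * \<sigma>\<^sup>2) * \<eta>\<^sup>2))))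
      * (exp (\<i> * of_real (- pi * \<eta> * (\<beta> * of_int k + ?x))) * cnj (exp (\<i> * of_real (- pi * \<eta> * (\<beta> * of_int l + ?x)))) * exp (\<i> * of_real (2 * pi * u * \<eta>)))"
      unfolding h_def gabor_term_def complex_cnj_mult complex_cnj_complex_of_real of_real_mult prod.case
      by (simp only: mult.assoc mult.commute mult.left_commute)
    then show ?thesis unfolding e1 e2 by (simp only: of_real_mult mult.assoc)
  qed
  define v where "v = (\<lambda>(k, l). c k * cnj (c l) * of_real (diag_weight \<sigma> \<beta> u (k - l)) * of_real (q powi ((k + l - n)\<^sup>2)))"
  \<comment> \<open>The inverse of what the Gaussian integral leaves over: \<pi> \<sigma>^2 sqrt
    (\<pi> / (2 \<pi>^2 \<sigma>^2)) = \<sigma> sqrt (\<pi> / 2), times exp (- u^2 / (4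
    \<sigma>^2)).\<close>
  define \<kappa> where "\<kappa> = exp (u\<^sup>2 / (4 * \<sigma>\<^sup>2)) / (\<sigma> * sqrt (pi / 2))"
  have \<kappa>: "\<kappa> > 0" using \<sigma> by (simp add: \<kappa>_def)
  have int: "has_bochner_integral lborel (h kl) (of_real (1 / \<kappa>) * v kl)" for kl
  proof (cases kl)
    case [simp]: (Pair k l)
    let ?\<omega> = "2 * pi * u - pi * \<beta> * of_int (k - l)"
    have ex: "?E k * ?E l * exp (- ?\<omega>\<^sup>2 / (4 * ?s)) = diag_weight \<sigma> \<beta> u (k - l) * q powi ((k + l - n)\<^sup>2) * exp (- u\<^sup>2 / (4 * \<sigma>\<^sup>2))"
    proof -
      have "?\<omega> = 2 * pi * (u - \<beta> * of_int (k - l) / 2)" by (simp add: field_simps)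
      then have "?\<omega>\<^sup>2 / (4 * ?s) = (2 * pi * (u - \<beta> * of_int (k - l) / 2))\<^sup>2 / (4 * ?s)" by (simp only:)
      also have "\<dots> = (u - \<beta> * of_int (k - l) / 2)\<^sup>2 / 2 / \<sigma>\<^sup>2" using \<sigma> by (simp add: power_mult_distrib)
      finally have 1: "?\<omega>\<^sup>2 / (4 * ?s) = (u - \<beta> * of_int (k - l) / 2)\<^sup>2 / 2 / \<sigma>\<^sup>2" .
      have "- (\<beta> * of_int k - ?x)\<^sup>2 / (4 * \<sigma>\<^sup>2) + - (\<beta> * of_int l - ?x)\<^sup>2 / (4 * \<sigma>\<^sup>2) + - ?\<omega>\<^sup>2 / (4 * ?s)
        = - (((\<beta> * of_int k - ?x)\<^sup>2 / 4 + (\<beta> * of_int l - ?x)\<^sup>2 / 4 + (u - \<beta> * of_int (k - l) / 2)\<^sup>2 / 2) / \<sigma>\<^sup>2)"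
        using 1 by (simp add: add_divide_distrib)
      also have "\<dots> = - (1 / \<sigma>\<^sup>2) * (\<beta> * of_int (k - l) / 2 - u / 2)\<^sup>2 + of_int ((k + l - n)\<^sup>2) * (- \<beta>\<^sup>2 / (8 * \<sigma>\<^sup>2)) + - u\<^sup>2 / (4 * \<sigma>\<^sup>2)"
        unfolding autocorrelation_exponent by (simp add: add_divide_distrib)
      finally show ?thesis
        unfolding diag_weight_def q_def exp_power_int exp_add[symmetric] by simp
    qed
    have "?E k * ?E l * (pi * \<sigma>\<^sup>2) * (sqrt (pi / ?s) * exp (- ?\<omega>\<^sup>2 / (4 * ?s)))
      = pi * \<sigma>\<^sup>2 * sqrt (pi / ?s) * (?E k * ?E l * exp (- ?\<omega>\<^sup>2 / (4 * ?s)))"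
      by (simp only: mult_ac)
    also have "\<dots> = pi * \<sigma>\<^sup>2 * sqrt (pi / ?s) * (diag_weight \<sigma> \<beta> u (k - l) * q powi ((k + l - n)\<^sup>2) * exp (- u\<^sup>2 / (4 * \<sigma>\<^sup>2)))"
      unfolding ex ..
    also have "\<dots> = 1 / \<kappa> * (diag_weight \<sigma> \<beta> u (k - l) * q powi ((k + l - n)\<^sup>2))"
    proof -
      have "pi * \<sigma>\<^sup>2 * sqrt (pi / ?s) = \<sigma> * sqrt (pi / 2)"
        unfolding sq using \<sigma> by (simp add: real_sqrt_mult real_sqrt_divide power2_eq_square field_simps)
      then show ?thesis using \<sigma> by (simp add: \<kappa>_def exp_minus field_simps)
    qed
    finally have eq: "?E k * ?E l * (pi * \<sigma>\<^sup>2) * (sqrt (pi / ?s) * exp (- ?\<omega>\<^sup>2 / (4 * ?s))) = 1 / \<kappa> * (diag_weight \<sigma> \<beta> u (k - l) * q powi ((k + l - n)\<^sup>2))" .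
    have "has_bochner_integral lborel (h kl) (c k * cnj (c l) * of_real (?E k * ?E l * (pi * \<sigma>\<^sup>2)) *
       (of_real (sqrt (pi / ?s) * exp (- ?\<omega>\<^sup>2 / (4 * ?s))) * exp (\<i> * of_real (?\<omega> * 0))))"
      unfolding Pair h by (intro has_bochner_integral_mult_right gauss_fourier s)
    also have "c k * cnj (c l) * of_real (?E k * ?E l * (pi * \<sigma>\<^sup>2)) *
       (of_real (sqrt (pi / ?s) * exp (- ?\<omega>\<^sup>2 / (4 * ?s))) * exp (\<i> * of_real (?\<omega> * 0)))
      = c k * cnj (c l) * of_real (?E k * ?E l * (pi * \<sigma>\<^sup>2) * (sqrt (pi / ?s) * exp (- ?\<omega>\<^sup>2 / (4 * ?s))))"
      by (simp only: of_real_mult mult_zero_right of_real_0 exp_zero mult_1_right mult.assoc)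
    also have "\<dots> = of_real (1 / \<kappa>) * v kl"
      unfolding eq v_def Pair prod.case by (simp only: of_real_mult mult_ac)
    finally show ?thesis .
  qed
  define B where "B = (\<lambda>(k, l). ?E k * ?E l * (C * C * (pi * \<sigma>\<^sup>2) * sqrt (pi / ?s)))"
  have bnd: "(\<integral>\<eta>. norm (h kl \<eta>) \<partial>lborel) \<le> B kl" for kl
  proof (cases kl)
    case [simp]: (Pair k l)
    have "(\<integral>\<eta>. norm (h kl \<eta>) \<partial>lborel) = (\<integral>\<eta>. (cmod (c k) * cmod (c l) * (?E k * ?E l * (pi * \<sigma>\<^sup>2))) * exp (- ?s * (\<eta> - 0)\<^sup>2) \<partial>lborel)"
      unfolding Pair h by (simp add: norm_mult norm_power)
    also have "\<dots> = cmod (c k) * cmod (c l) * (?E k * ?E l * (pi * \<sigma>\<^sup>2)) * sqrt (pi / ?s)"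
      using has_bochner_integral_integral_eq[OF gauss_integral[OF s, of 0]] by simp
    also have "\<dots> \<le> C * C * (?E k * ?E l * (pi * \<sigma>\<^sup>2)) * sqrt (pi / ?s)"
      using C[of k] C[of l] Cnn by (intro mult_right_mono mult_mono) auto
    finally show ?thesis by (simp add: B_def mult_ac)
  qed
  have Bs: "B summable_on UNIV"
  proof -
    have "((\<lambda>l. B (k, l)) has_sum ?E k * infsum ?E UNIV * (C * C * (pi * \<sigma>\<^sup>2) * sqrt (pi / ?s))) UNIV" for k
      unfolding B_def prod.case using S by (intro has_sum_cmult_left has_sum_cmult_right has_sum_infsum)
    then have "B summable_on (UNIV \<times> UNIV)"
      using Cnn by (intro summable_on_SigmaI[where g = "\<lambda>k. ?E k * infsum ?E UNIV * (C * C * (pi * \<sigma>\<^sup>2) * sqrt (pi / ?s))"] summable_on_cmult_left S)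
        (auto simp: B_def)
    then show ?thesis by simp
  qed
  have Fsum: "((\<lambda>kl. h kl \<eta>) has_sum F \<eta>) UNIV" and Fabs: "(\<lambda>kl. norm (h kl \<eta>)) summable_on UNIV" for \<eta>
  proof -
    note * = has_sum_times[OF V[of \<eta>] V'[of \<eta>]]
    have "((\<lambda>kl. (\<lambda>(k, l). ?t \<eta> k * cnj (?t \<eta> l)) kl * exp (\<i> * of_real (2 * pi * u * \<eta>))) has_sum ?V \<eta> * cnj (?V \<eta>) * exp (\<i> * of_real (2 * pi * u * \<eta>))) UNIV"
      by (intro has_sum_cmult_left *)
    then show "((\<lambda>kl. h kl \<eta>) has_sum F \<eta>) UNIV"
      unfolding h_def F_def complex_norm_square by (simp only: case_prod_unfold)
    have "norm (h kl \<eta>) = (\<lambda>(k, l). norm (?t \<eta> k * cnj (?t \<eta> l))) kl" for kl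
      by (simp add: h_def norm_mult case_prod_unfold)
    then show "(\<lambda>kl. norm (h kl \<eta>)) summable_on UNIV" using *(2) by presburger
  qed
  have inf: "infinite (UNIV :: (int \<times> int) set)" by (simp add: finite_prod)
  note main = has_bochner_integral_has_sum[OF inf int bnd Bs Fabs Fsum]
  show "integrable lborel F" by (rule main(1))
  have "((\<lambda>kl. of_real \<kappa> * (of_real (1 / \<kappa>) * v kl)) has_sum of_real \<kappa> * integral\<^sup>L lborel F) UNIV"
    by (rule has_sum_cmult_right[OF main(2)])
  then have "(v has_sum of_real \<kappa> * integral\<^sup>L lborel F) UNIV"
    using \<kappa> by (simp flip: mult.assoc)
  then show "((\<lambda>m. diag_coeff \<sigma> \<beta> u c m * of_real (q powi ((m - n)\<^sup>2))) has_sum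
      of_real (exp (u\<^sup>2 / (4 * \<sigma>\<^sup>2)) / (\<sigma> * sqrt (pi / 2))) * integral\<^sup>L lborel F) UNIV"
    unfolding v_def \<kappa>_def by (rule has_sum_diag_coeff[OF \<sigma> \<beta> c])
qed

text \<open>The parallelogram identity for s + u/2 - \<beta> k and s - u/2 - \<beta> l separates
  half their difference, a function of k - l, from their mean, a function of k + l.\<close>

lemma product_expansion:
  assumes \<sigma>: "\<sigma> > 0" and \<beta>: "\<beta> > 0" and c: "bounded (range c)"
    and f: "\<And>t. ((\<lambda>k. c k * gauss \<sigma> (t - \<beta> * of_int k)) has_sum f t) UNIV"
  shows "((\<lambda>m. diag_coeff \<sigma> \<beta> u c m * of_real (exp (- (1 / \<sigma>\<^sup>2) * (s - \<beta> / 2 * of_int m)\<^sup>2))) has_sum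
      f (s + u / 2) * cnj (f (s - u / 2))) UNIV"
proof (rule has_sum_diag_coeff[OF \<sigma> \<beta> c])
  let ?a = "\<lambda>k. c k * gauss \<sigma> (s + u / 2 - \<beta> * of_int k)" and ?b = "\<lambda>l. cnj (c l * gauss \<sigma> (s - u / 2 - \<beta> * of_int l))"
  have "((\<lambda>(k, l). ?a k * ?b l) has_sum f (s + u / 2) * cnj (f (s - u / 2))) UNIV"
    using f summable_gauss[OF \<sigma> \<beta> c] by (intro has_sum_times(1)) (simp_all only: has_sum_cnj_iff complex_mod_cnj)
  moreover have "?a k * ?b l = c k * cnj (c l) * of_real (diag_weight \<sigma> \<beta> u (k - l)) *
    of_real (exp (- (1 / \<sigma>\<^sup>2) * (s - \<beta> / 2 * of_int (k + l))\<^sup>2))" for k l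
  proof -
    have "((s + u / 2 - \<beta> * of_int k)\<^sup>2 + (s - u / 2 - \<beta> * of_int l)\<^sup>2) / 2 =
      (\<beta> * of_int (k - l) / 2 - u / 2)\<^sup>2 + (s - \<beta> / 2 * of_int (k + l))\<^sup>2"
      by (simp add: power2_eq_square field_simps)
    then have "((s + u / 2 - \<beta> * of_int k)\<^sup>2 + (s - u / 2 - \<beta> * of_int l)\<^sup>2) / 2 / \<sigma>\<^sup>2 =
      ((\<beta> * of_int (k - l) / 2 - u / 2)\<^sup>2 + (s - \<beta> / 2 * of_int (k + l))\<^sup>2) / \<sigma>\<^sup>2"
      by (rule arg_cong[where f = "\<lambda>z. z / \<sigma>\<^sup>2"])
    then have "- (s + u / 2 - \<beta> * of_int k)\<^sup>2 / (2 * \<sigma>\<^sup>2) + - (s - u / 2 - \<beta> * of_int l)\<^sup>2 / (2 * \<sigma>\<^sup>2)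
      = - (1 / \<sigma>\<^sup>2) * (\<beta> * of_int (k - l) / 2 - u / 2)\<^sup>2 + - (1 / \<sigma>\<^sup>2) * (s - \<beta> / 2 * of_int (k + l))\<^sup>2"
      using \<sigma> by (simp add: add_divide_distrib diff_divide_distrib)
    then have "exp (- (s + u / 2 - \<beta> * of_int k)\<^sup>2 / (2 * \<sigma>\<^sup>2)) * exp (- (s - u / 2 - \<beta> * of_int l)\<^sup>2 / (2 * \<sigma>\<^sup>2))
      = diag_weight \<sigma> \<beta> u (k - l) * exp (- (1 / \<sigma>\<^sup>2) * (s - \<beta> / 2 * of_int (k + l))\<^sup>2)"
      unfolding diag_weight_def exp_add[symmetric] by simp
    then have "gauss \<sigma> (s + u / 2 - \<beta> * of_int k) * gauss \<sigma> (s - u / 2 - \<beta> * of_int l)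
      = of_real (diag_weight \<sigma> \<beta> u (k - l)) * of_real (exp (- (1 / \<sigma>\<^sup>2) * (s - \<beta> / 2 * of_int (k + l))\<^sup>2))"
      unfolding gauss_def of_real_mult[symmetric] by simp
    moreover have "cnj (gauss \<sigma> x) = gauss \<sigma> x" for x by (simp add: gauss_def)
    ultimately show ?thesis unfolding complex_cnj_mult by (metis (no_types, lifting) mult.assoc mult.left_commute)
  qed
  ultimately show "((\<lambda>(k, l). c k * cnj (c l) * of_real (diag_weight \<sigma> \<beta> u (k - l)) *
    of_real (exp (- (1 / \<sigma>\<^sup>2) * (s - \<beta> / 2 * of_int (k + l))\<^sup>2))) has_sum f (s + u / 2) * cnj (f (s - u / 2))) UNIV"
    by (simp only:)
qed

section \<open>Deconvolution\<close>

lemma theta3_real_has_sum: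
  assumes "0 < q" "q < 1"
  shows "((\<lambda>n::int. of_real (q powi (n\<^sup>2)) * exp (\<i> * of_real (2 * of_int n * z))) has_sum theta3 (of_real z) (of_real q)) UNIV"
proof -
  have "((\<lambda>n::int. of_real (q powi (n\<^sup>2)) * exp (\<i> * of_real (2 * of_int n * z))) has_sum
    (\<Sum>\<^sub>\<infinity>n::int. of_real (q powi (n\<^sup>2)) * exp (\<i> * of_real (2 * of_int n * z)))) UNIV"
    by (intro has_sum_infsum, rule abs_summable_summable)
      (use assms summable_powi_square[OF assms] in \<open>simp add: norm_mult norm_power_int\<close>)
  moreover have "(of_real q :: complex) powi (n\<^sup>2) * exp (2 * of_int n * \<i> * of_real z) = of_real (q powi (n\<^sup>2)) * exp (\<i> * of_real (2 * of_int n * z))" for n :: int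
    by (simp add: mult_ac)
  ultimately show ?thesis unfolding theta3_def by (simp only:)
qed

text \<open>The character n -> exp (2 i n z) is a bounded eigenvector of convolution with q^(j^2),
  with eigenvalue theta at z. Boundedness below of the convolution bounds the eigenvalue.\<close>

lemma theta3_lower_bound:
  assumes "0 < q" "q < 1"
  obtains \<delta> where "\<delta> > 0" "\<And>z::real. \<delta> \<le> cmod (theta3 (of_real z) (of_real q))"
proof -
  from theta_convolution_bounded_below[OF assms] obtain K where K: "K > 0"
    "\<And>(d :: int \<Rightarrow> complex) B n. bounded (range d) \<Longrightarrow>
      (\<And>n. cmod (\<Sum>\<^sub>\<infinity>j. of_real (q powi (j\<^sup>2)) * d (n + j)) \<le> B) \<Longrightarrow> cmod (d n) \<le> K * B"
    by metis
  have "1 / K \<le> cmod (theta3 (of_real z) (of_real q))" for z :: real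
  proof -
    define d :: "int \<Rightarrow> complex" where "d n = exp (\<i> * of_real (2 * of_int n * z))" for n
    have d: "cmod (d n) = 1" for n by (simp add: d_def)
    have "(\<Sum>\<^sub>\<infinity>j. of_real (q powi (j\<^sup>2)) * d (n + j)) = d n * theta3 (of_real z) (of_real q)" for n
    proof (rule infsumI)
      have "d n * (of_real (q powi (j\<^sup>2)) * exp (\<i> * of_real (2 * of_int j * z))) = of_real (q powi (j\<^sup>2)) * d (n + j)" for j
        by (simp add: d_def algebra_simps flip: exp_add)
      then show "((\<lambda>j. of_real (q powi (j\<^sup>2)) * d (n + j)) has_sum d n * theta3 (of_real z) (of_real q)) UNIV"
        using has_sum_cmult_right[OF theta3_real_has_sum[OF assms, of z], of "d n"] by (simp only:)
    qed
    then have "cmod (d 0) \<le> K * cmod (theta3 (of_real z) (of_real q))"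
      by (intro K(2)) (auto simp: bounded_iff d norm_mult)
    then show ?thesis using K(1) d by (simp add: field_simps)
  qed
  then show thesis using that[of "1 / K"] K(1) by simp
qed

lemma theta3_real_continuous:
  assumes "0 < q" "q < 1"
  shows "continuous_on UNIV (\<lambda>z::real. theta3 (of_real z) (of_real q))"
proof (rule uniform_limit_theorem)
  show "uniform_limit UNIV (\<lambda>X z. \<Sum>n\<in>X. of_real (q powi (n\<^sup>2)) * exp (\<i> * of_real (2 * of_int n * z)))
      (\<lambda>z. theta3 (of_real z) (of_real q)) (finite_subsets_at_top (UNIV :: int set))"
    by (rule Weierstrass_m_test_general'[OF _ theta3_real_has_sum[OF assms] summable_powi_square[OF assms]])
      (use assms in \<open>simp add: norm_mult norm_power_int\<close>)
  show "\<forall>\<^sub>F X in finite_subsets_at_top UNIV. continuous_on UNIV (\<lambda>z. \<Sum>n\<in>X. of_real (q powi (n\<^sup>2)) * exp (\<i> * of_real (2 * of_int n * z)) :: complex)"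
    by (intro always_eventually allI continuous_intros)
qed auto

context
  fixes \<sigma> \<beta> q :: real
  assumes \<sigma>: "\<sigma> > 0" and \<beta>: "\<beta> > 0" and q_def: "q = exp (- \<beta>\<^sup>2 / (8 * \<sigma>\<^sup>2))"
begin

lemma theta_nome_bounds: "0 < q" "q < 1"
proof -
  have "\<beta>\<^sup>2 / (8 * \<sigma>\<^sup>2) > 0" using \<sigma> \<beta> by simp
  then show "0 < q" "q < 1" unfolding q_def by simp_all
qed

text \<open>A quotient by 0 would be 0, so this cancellation rests on theta having no real
  zeros.\<close>

lemma Lambda_fun_theta3:
  "Lambda_fun \<sigma> \<beta> u * theta3 (of_real (\<beta> / 2 * pi * u)) (of_real q) = of_real (exp (- (pi\<^sup>2 * \<sigma>\<^sup>2) * (u - 0)\<^sup>2))"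
proof -
  obtain \<delta> where "\<delta> > 0" "\<And>z::real. \<delta> \<le> cmod (theta3 (of_real z) (of_real q))"
    using theta3_lower_bound[OF theta_nome_bounds] by blast
  then have "theta3 (of_real (\<beta> / 2 * pi * u)) (of_real q) \<noteq> 0"
    by (metis norm_zero not_less)
  then show ?thesis
    unfolding Lambda_fun_def q_def[symmetric] by (simp add: mult_ac)
qed

lemma Lambda_fun_bound:
  obtains D where "D > 0" "\<And>u. cmod (Lambda_fun \<sigma> \<beta> u) \<le> D * exp (- (pi\<^sup>2 * \<sigma>\<^sup>2) * (u - 0)\<^sup>2)"
proof -
  obtain \<delta> where \<delta>: "\<delta> > 0" "\<And>z::real. \<delta> \<le> cmod (theta3 (of_real z) (of_real q))"
    using theta3_lower_bound[OF theta_nome_bounds] by blast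
  have "cmod (Lambda_fun \<sigma> \<beta> u) \<le> 1 / \<delta> * exp (- (pi\<^sup>2 * \<sigma>\<^sup>2) * (u - 0)\<^sup>2)" for u
  proof -
    have "cmod (Lambda_fun \<sigma> \<beta> u) * \<delta> \<le> cmod (Lambda_fun \<sigma> \<beta> u) * cmod (theta3 (of_real (\<beta> / 2 * pi * u)) (of_real q))"
      by (intro mult_left_mono \<delta>) auto
    also have "\<dots> = exp (- (pi\<^sup>2 * \<sigma>\<^sup>2) * (u - 0)\<^sup>2)"
      unfolding norm_mult[symmetric] Lambda_fun_theta3 by simp
    finally show ?thesis using \<delta>(1) by (simp add: field_simps)
  qed
  then show thesis using that[of "1 / \<delta>"] \<delta>(1) by simp
qed

lemma Lambda_fun_integrable: "integrable lborel (Lambda_fun \<sigma> \<beta>)"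
proof -
  obtain D where D: "D > 0" "\<And>u. cmod (Lambda_fun \<sigma> \<beta> u) \<le> D * exp (- (pi\<^sup>2 * \<sigma>\<^sup>2) * (u - 0)\<^sup>2)"
    using Lambda_fun_bound by blast
  have "pi\<^sup>2 * \<sigma>\<^sup>2 > 0" using \<sigma> by simp
  then have "integrable lborel (\<lambda>u. D * exp (- (pi\<^sup>2 * \<sigma>\<^sup>2) * (u - 0)\<^sup>2))"
    using gauss_integral[of "pi\<^sup>2 * \<sigma>\<^sup>2" 0] by (intro integrable_mult_right) (auto simp: has_bochner_integral_iff)
  then show ?thesis
  proof (rule Bochner_Integration.integrable_bound)
    have "continuous_on UNIV (\<lambda>u. theta3 (of_real (\<beta> / 2 * pi * u)) (of_real q))"
      by (rule continuous_on_compose2[where f = "\<lambda>u. \<beta> / 2 * pi * u", OF theta3_real_continuous[OF theta_nome_bounds]])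
        (intro continuous_intros subset_UNIV)+
    then have "(\<lambda>u. theta3 (of_real (\<beta> / 2 * pi * u)) (of_real q)) \<in> borel_measurable borel"
      by (rule borel_measurable_continuous_onI)
    then show "Lambda_fun \<sigma> \<beta> \<in> borel_measurable lborel"
      unfolding Lambda_fun_def[abs_def] q_def[symmetric] by measurable
    show "AE u in lborel. norm (Lambda_fun \<sigma> \<beta> u) \<le> norm (D * exp (- (pi\<^sup>2 * \<sigma>\<^sup>2) * (u - 0)\<^sup>2))"
      using D by (intro AE_I2) (metis abs_of_nonneg order_trans norm_ge_zero real_norm_def)
  qed
qed

text \<open>On the Fourier side, multiplication by theta is a sum of translations by multiples of
  \<beta> / 2, and it turns \<Lambda> into a Gaussian. Thus the inverse transform of \<Lambda> is
  the kernel that undoes convolution with q^(n^2).\<close>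

lemma inv_fourier_Lambda_expansion:
  "((\<lambda>n. of_real (q powi ((m - n)\<^sup>2)) * inv_fourier (Lambda_fun \<sigma> \<beta>) (s - \<beta> / 2 * of_int n)) has_sum
    of_real (exp (- (1 / \<sigma>\<^sup>2) * (s - \<beta> / 2 * of_int m)\<^sup>2) / (\<sigma> * sqrt pi))) UNIV"
proof -
  let ?L = "Lambda_fun \<sigma> \<beta>"
  let ?e = "\<lambda>n u. exp (2 * of_real pi * \<i> * of_real u * of_real (s - \<beta> / 2 * of_int n)) :: complex"
  let ?h = "\<lambda>n u. of_real (q powi ((m - n)\<^sup>2)) * (?L u * ?e n u)"
  let ?\<omega> = "2 * pi * (s - \<beta> / 2 * of_int m)"
  have e: "?e n u = exp (\<i> * of_real (2 * pi * u * (s - \<beta> / 2 * of_int n)))" for n u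
    by (simp add: mult_ac)
  have ne: "cmod (?e n u) = 1" for n u unfolding e by (rule norm_exp_i_times)
  have intLe: "integrable lborel (\<lambda>u. ?L u * ?e n u)" for n
  proof (rule Bochner_Integration.integrable_bound[OF Lambda_fun_integrable])
    show "AE u in lborel. norm (?L u * ?e n u) \<le> norm (?L u)" unfolding norm_mult ne by simp
    show "(\<lambda>u. ?L u * ?e n u) \<in> borel_measurable lborel"
      using borel_measurable_integrable[OF Lambda_fun_integrable] by measurable
  qed
  have int: "has_bochner_integral lborel (?h n) (of_real (q powi ((m - n)\<^sup>2)) * inv_fourier ?L (s - \<beta> / 2 * of_int n))" for n
    unfolding inv_fourier_def
    by (intro has_bochner_integral_mult_right has_bochner_integral_integrable intLe)
  have summ: "(\<lambda>n. q powi ((m - n)\<^sup>2)) summable_on UNIV"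
    using summable_powi_square[OF theta_nome_bounds] summable_on_reindex_bij_witness[of UNIV "\<lambda>j. m - j" "\<lambda>n. m - n" UNIV "\<lambda>j. q powi (j\<^sup>2)" "\<lambda>n. q powi ((m - n)\<^sup>2)"] by simp
  have nh: "norm (?h n u) = q powi ((m - n)\<^sup>2) * cmod (?L u)" for n u
    unfolding norm_mult ne using theta_nome_bounds by (simp add: norm_power_int)
  have hsum: "((\<lambda>n. ?h n u) has_sum of_real (exp (- (pi\<^sup>2 * \<sigma>\<^sup>2) * (u - 0)\<^sup>2)) * exp (\<i> * of_real (?\<omega> * u))) UNIV" for u
  proof -
    let ?T = "theta3 (of_real (\<beta> / 2 * pi * u)) (of_real q)"
    have "((\<lambda>j. ?L u * exp (\<i> * of_real (?\<omega> * u)) * (of_real (q powi (j\<^sup>2)) * exp (\<i> * of_real (2 * of_int j * (\<beta> / 2 * pi * u)))))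
       has_sum ?L u * exp (\<i> * of_real (?\<omega> * u)) * ?T) UNIV"
      by (intro has_sum_cmult_right theta3_real_has_sum theta_nome_bounds)
    moreover have "?L u * exp (\<i> * of_real (?\<omega> * u)) * ?T = of_real (exp (- (pi\<^sup>2 * \<sigma>\<^sup>2) * (u - 0)\<^sup>2)) * exp (\<i> * of_real (?\<omega> * u))"
      unfolding Lambda_fun_theta3[symmetric] by (simp only: mult_ac)
    moreover have "?h n u = ?L u * exp (\<i> * of_real (?\<omega> * u)) * (of_real (q powi ((m - n)\<^sup>2)) * exp (\<i> * of_real (2 * of_int (m - n) * (\<beta> / 2 * pi * u))))" for n
    proof -
      have "?\<omega> * u + 2 * of_int (m - n) * (\<beta> / 2 * pi * u) = 2 * pi * u * (s - \<beta> / 2 * of_int n)"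
        by (simp add: algebra_simps)
      then have "?e n u = exp (\<i> * of_real (?\<omega> * u)) * exp (\<i> * of_real (2 * of_int (m - n) * (\<beta> / 2 * pi * u)))"
        unfolding e exp_add[symmetric] distrib_left[symmetric] of_real_add[symmetric] by simp
      then show ?thesis by (simp only: mult_ac)
    qed
    ultimately show ?thesis
      by (subst has_sum_reindex_bij_witness[of UNIV "\<lambda>j. m - j" "\<lambda>n. m - n" UNIV
          "\<lambda>j. ?L u * exp (\<i> * of_real (?\<omega> * u)) * (of_real (q powi (j\<^sup>2)) * exp (\<i> * of_real (2 * of_int j * (\<beta> / 2 * pi * u))))", OF _ _ _ _ _ refl])
        (simp_all only: UNIV_I diff_diff_eq2 add_diff_cancel_left')
  qed
  have s: "pi\<^sup>2 * \<sigma>\<^sup>2 > 0" using \<sigma> by simp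
  have "((\<lambda>n. of_real (q powi ((m - n)\<^sup>2)) * inv_fourier ?L (s - \<beta> / 2 * of_int n)) has_sum
     (\<integral>u. of_real (exp (- (pi\<^sup>2 * \<sigma>\<^sup>2) * (u - 0)\<^sup>2)) * exp (\<i> * of_real (?\<omega> * u)) \<partial>lborel)) UNIV"
  proof (rule has_bochner_integral_has_sum(2)[OF _ int _ _ _ hsum])
    show "(\<integral>u. norm (?h n u) \<partial>lborel) \<le> q powi ((m - n)\<^sup>2) * (\<integral>u. cmod (?L u) \<partial>lborel)" for n
      unfolding nh by simp
    show "(\<lambda>n. q powi ((m - n)\<^sup>2) * (\<integral>u. cmod (?L u) \<partial>lborel)) summable_on UNIV"
      "(\<lambda>n. norm (?h n u)) summable_on UNIV" for u
      unfolding nh by (intro summable_on_cmult_left summ)+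
  qed auto
  also have "(\<integral>u. of_real (exp (- (pi\<^sup>2 * \<sigma>\<^sup>2) * (u - 0)\<^sup>2)) * exp (\<i> * of_real (?\<omega> * u)) \<partial>lborel)
    = of_real (sqrt (pi / (pi\<^sup>2 * \<sigma>\<^sup>2)) * exp (- ?\<omega>\<^sup>2 / (4 * (pi\<^sup>2 * \<sigma>\<^sup>2)))) * exp (\<i> * of_real (?\<omega> * 0))"
    by (rule has_bochner_integral_integral_eq[OF gauss_fourier[OF s]])
  also have "sqrt (pi / (pi\<^sup>2 * \<sigma>\<^sup>2)) = 1 / (\<sigma> * sqrt pi)"
    using \<sigma> by (simp add: real_sqrt_mult real_sqrt_divide power2_eq_square)
  also have "- ?\<omega>\<^sup>2 / (4 * (pi\<^sup>2 * \<sigma>\<^sup>2)) = - (1 / \<sigma>\<^sup>2) * (s - \<beta> / 2 * of_int m)\<^sup>2"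
    unfolding power_mult_distrib by simp
  finally show ?thesis by (simp add: mult.commute)
qed

text \<open>Replacing each Gaussian by the expansion above and exchanging the sums gives G as
  \<sigma> sqrt \<pi> times the sum of Y n \<Psi> n. This requires absolute summability of \<Psi>;
  the cases where the bound is 0 or \<Psi> is not summable are separate.\<close>

lemma deconvolution_bound:
  fixes d :: "int \<Rightarrow> complex" and y :: real
  assumes d: "bounded (range d)"
    and G: "((\<lambda>m. d m * of_real (exp (- (1 / \<sigma>\<^sup>2) * (s - \<beta> / 2 * of_int m)\<^sup>2))) has_sum G) UNIV"
    and Y: "\<And>n. ((\<lambda>m. d m * of_real (q powi ((m - n)\<^sup>2))) has_sum Y n) UNIV"
    and y: "\<And>n. cmod (Y n) \<le> y"
  shows "ennreal (cmod G) \<le> ennreal (\<sigma> * sqrt pi * y) * C_const \<sigma> \<beta>"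
proof -
  from d obtain D where D: "\<And>k. cmod (d k) \<le> D" by (auto simp: bounded_iff)
  have ynn: "y \<ge> 0" using y norm_ge_zero order_trans by blast
  define \<Psi> where "\<Psi> n = inv_fourier (Lambda_fun \<sigma> \<beta>) (s - \<beta> / 2 * of_int n)" for n
  define P where "P = (\<Sum>\<^sub>\<infinity>n::int. ennreal (cmod (\<Psi> n)))"
  have PC: "P \<le> C_const \<sigma> \<beta>"
    unfolding P_def C_const_def \<Psi>_def by (rule SUP_upper) simp
  show ?thesis
  proof (cases "y = 0")
    \<comment> \<open>C(\<sigma>, \<beta>) might be infinite, but 0 * \<infinity> = 0, so G = 0 has
      to be proved. The convolution with q^(j^2) is injective on bounded sequences, hence d =
      0.\<close>
    case True
    from theta_convolution_bounded_below[OF theta_nome_bounds] obtain K where K: "K > 0"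
      "\<And>(d :: int \<Rightarrow> complex) B n. bounded (range d) \<Longrightarrow>
        (\<And>n. cmod (\<Sum>\<^sub>\<infinity>j. of_real (q powi (j\<^sup>2)) * d (n + j)) \<le> B) \<Longrightarrow> cmod (d n) \<le> K * B"
      by metis
    have "(\<Sum>\<^sub>\<infinity>j. of_real (q powi (j\<^sup>2)) * d (n + j)) = Y n" for n
    proof (rule infsumI)
      show "((\<lambda>j. of_real (q powi (j\<^sup>2)) * d (n + j)) has_sum Y n) UNIV"
        using Y[of n] by (subst has_sum_reindex_bij_witness[of UNIV "\<lambda>m. m - n" "\<lambda>j. n + j" UNIV "\<lambda>m. d m * of_real (q powi ((m - n)\<^sup>2))" _ _ "Y n"]) auto
    qed
    then have "cmod (d n) \<le> K * 0" for n
      using y True by (intro K(2) d) simp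
    then have "G = 0" using has_sum_unique[OF G has_sum_0[of UNIV]] by simp
    then show ?thesis by simp
  next
    case False
    then have ypos: "y > 0" using ynn by simp
    show ?thesis
    proof (cases "P = \<infinity>")
      case True
      then have "C_const \<sigma> \<beta> = \<infinity>" using PC by (simp add: top_unique)
      then show ?thesis using ypos \<sigma> by (simp add: ennreal_mult_top)
    next
      case False
      have abs: "(\<lambda>n. cmod (\<Psi> n)) summable_on UNIV"
      proof (rule nonneg_bdd_above_summable_on)
        show "bdd_above (sum (\<lambda>n. cmod (\<Psi> n)) ` {F. F \<subseteq> UNIV \<and> finite F})"
        proof (rule bdd_aboveI2)
          fix F :: "int set" assume "F \<in> {F. F \<subseteq> UNIV \<and> finite F}"
          then have F: "finite F" by simp
          have "ennreal (\<Sum>n\<in>F. cmod (\<Psi> n)) = (\<Sum>n\<in>F. ennreal (cmod (\<Psi> n)))" by (simp add: sum_ennreal)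
          also have "\<dots> = infsum (\<lambda>n. ennreal (cmod (\<Psi> n))) F" using F by simp
          also have "\<dots> \<le> P" unfolding P_def by (rule infsum_mono_neutral) (auto intro: nonneg_summable_on_complete)
          finally show "(\<Sum>n\<in>F. cmod (\<Psi> n)) \<le> enn2real P"
            using False by (subst (asm) ennreal_enn2real[of P, symmetric]) (auto simp: top.not_eq_extremum enn2real_nonneg)
        qed
      qed auto
      define p where "p = (\<Sum>\<^sub>\<infinity>n. cmod (\<Psi> n))"
      have pP: "ennreal p = P"
      proof -
        have "(ennreal \<circ> (\<lambda>n. cmod (\<Psi> n)) has_sum ennreal p) UNIV"
        proof (rule has_sum_comm_additive_general)
          show "((\<lambda>n. cmod (\<Psi> n)) has_sum p) UNIV" unfolding p_def using abs by simp
          have "isCont ennreal p" using continuous_on_ennreal[OF continuous_on_id[of UNIV]] by (simp add: continuous_on_eq_continuous_at)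
          then show "ennreal \<midarrow>p\<rightarrow> ennreal p" by (simp add: isCont_def)
        qed (auto simp: sum_ennreal)
        then show ?thesis unfolding P_def by (simp add: infsumI o_def)
      qed
      let ?c = "complex_of_real (\<sigma> * sqrt pi)"
      have cpos: "\<sigma> * sqrt pi > 0" using \<sigma> by simp
      \<comment> \<open>Summing over n first rebuilds the Gaussian and gives G; summing over m first
        gives the data Y n.\<close>
      define T where "T = (\<lambda>(m, n). d m * (?c * (of_real (q powi ((m - n)\<^sup>2)) * \<Psi> n)))"
      have summ: "((\<lambda>m. q powi ((m - n)\<^sup>2)) has_sum (\<Sum>\<^sub>\<infinity>j. q powi (j\<^sup>2))) UNIV" for n :: int
        using has_sum_infsum[OF summable_powi_square[OF theta_nome_bounds]]
        by (subst has_sum_reindex_bij_witness[of UNIV "\<lambda>j. j + n" "\<lambda>m. m - n" UNIV "\<lambda>j. q powi (j\<^sup>2)" _ _ "\<Sum>\<^sub>\<infinity>j. q powi (j\<^sup>2)"]) auto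
      let ?Q = "\<Sum>\<^sub>\<infinity>j::int. q powi (j\<^sup>2)"
      have "(\<lambda>(n, m). D * (\<sigma> * sqrt pi) * (q powi ((m - n)\<^sup>2) * cmod (\<Psi> n))) summable_on (UNIV \<times> UNIV)"
      proof (rule summable_on_SigmaI[where g = "\<lambda>n. D * (\<sigma> * sqrt pi) * (?Q * cmod (\<Psi> n))"])
        show "((\<lambda>m. (\<lambda>(n, m). D * (\<sigma> * sqrt pi) * (q powi ((m - n)\<^sup>2) * cmod (\<Psi> n))) (n, m)) has_sum D * (\<sigma> * sqrt pi) * (?Q * cmod (\<Psi> n))) UNIV" for n
          unfolding prod.case by (intro has_sum_cmult_right has_sum_cmult_left summ)
        show "(\<lambda>n. D * (\<sigma> * sqrt pi) * (?Q * cmod (\<Psi> n))) summable_on UNIV"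
          by (intro summable_on_cmult_right abs)
        show "0 \<le> (\<lambda>(n, m). D * (\<sigma> * sqrt pi) * (q powi ((m - n)\<^sup>2) * cmod (\<Psi> n))) (n, m)" for n m
          using theta_nome_bounds order_trans[OF norm_ge_zero D] cpos by (auto intro!: mult_nonneg_nonneg)
      qed
      moreover have "norm (case nm of (n, m) \<Rightarrow> T (m, n)) \<le> (case nm of (n, m) \<Rightarrow> D * (\<sigma> * sqrt pi) * (q powi ((m - n)\<^sup>2) * cmod (\<Psi> n)))" for nm
      proof -
        obtain n m where nm: "nm = (n, m)" by (cases nm)
        have "norm (T (m, n)) = cmod (d m) * ((\<sigma> * sqrt pi) * (q powi ((m - n)\<^sup>2) * cmod (\<Psi> n)))"
          using theta_nome_bounds \<sigma> by (simp add: T_def norm_mult norm_power_int)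
        also have "\<dots> \<le> D * ((\<sigma> * sqrt pi) * (q powi ((m - n)\<^sup>2) * cmod (\<Psi> n)))"
          using theta_nome_bounds \<sigma> by (intro mult_right_mono D) auto
        finally show ?thesis by (simp only: nm prod.case mult.assoc)
      qed
      ultimately have "(\<lambda>nm. norm (case nm of (n, m) \<Rightarrow> T (m, n))) summable_on (UNIV \<times> UNIV)"
        by (intro Infinite_Sum.abs_summable_on_comparison_test')
      then have "(\<lambda>nm. case nm of (n, m) \<Rightarrow> T (m, n)) summable_on (UNIV \<times> UNIV)" by (rule abs_summable_summable)
      then obtain S where S1: "((\<lambda>(n, m). T (m, n)) has_sum S) (UNIV \<times> UNIV)"
        by (auto simp: summable_on_def)
      then have S2: "(T has_sum S) (UNIV \<times> UNIV)"
        by (subst has_sum_swap) (simp only: case_prod_unfold)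
      have "((\<lambda>m. d m * of_real (exp (- (1 / \<sigma>\<^sup>2) * (s - \<beta> / 2 * of_int m)\<^sup>2))) has_sum S) UNIV"
      proof (rule has_sum_SigmaD[OF S2])
        fix m
        have "((\<lambda>n. T (m, n)) has_sum d m * (?c * of_real (exp (- (1 / \<sigma>\<^sup>2) * (s - \<beta> / 2 * of_int m)\<^sup>2) / (\<sigma> * sqrt pi)))) UNIV"
          unfolding T_def \<Psi>_def prod.case by (intro has_sum_cmult_right inv_fourier_Lambda_expansion)
        also have "?c * of_real (exp (- (1 / \<sigma>\<^sup>2) * (s - \<beta> / 2 * of_int m)\<^sup>2) / (\<sigma> * sqrt pi)) = of_real (exp (- (1 / \<sigma>\<^sup>2) * (s - \<beta> / 2 * of_int m)\<^sup>2))"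
          unfolding of_real_mult[symmetric] using \<sigma> by simp
        finally show "((\<lambda>n. T (m, n)) has_sum d m * of_real (exp (- (1 / \<sigma>\<^sup>2) * (s - \<beta> / 2 * of_int m)\<^sup>2))) UNIV" .
      qed
      then have SG: "S = G" using G has_sum_unique by blast
      have "((\<lambda>n. Y n * (?c * \<Psi> n)) has_sum S) UNIV"
      proof (rule has_sum_SigmaD[OF S1])
        fix n
        have "((\<lambda>m. d m * of_real (q powi ((m - n)\<^sup>2)) * (?c * \<Psi> n)) has_sum Y n * (?c * \<Psi> n)) UNIV"
          by (rule has_sum_cmult_left[OF Y])
        then show "((\<lambda>m. (\<lambda>(n, m). T (m, n)) (n, m)) has_sum Y n * (?c * \<Psi> n)) UNIV"
          unfolding T_def prod.case by (simp only: mult_ac)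
      qed
      then have "cmod S \<le> \<sigma> * sqrt pi * y * p"
      proof (rule norm_infsum_le)
        show "((\<lambda>n. \<sigma> * sqrt pi * y * cmod (\<Psi> n)) has_sum \<sigma> * sqrt pi * y * p) UNIV"
          unfolding p_def by (intro has_sum_cmult_right has_sum_infsum abs)
        show "norm (Y n * (?c * \<Psi> n)) \<le> \<sigma> * sqrt pi * y * cmod (\<Psi> n)" for n
        proof -
          have "norm (Y n * (?c * \<Psi> n)) = cmod (Y n) * (\<sigma> * sqrt pi * cmod (\<Psi> n))"
            using \<sigma> by (simp add: norm_mult)
          also have "\<dots> \<le> y * (\<sigma> * sqrt pi * cmod (\<Psi> n))"
            using \<sigma> by (intro mult_right_mono y) auto
          finally show ?thesis by (simp only: mult_ac)
        qed
      qed
      then have "ennreal (cmod G) \<le> ennreal (\<sigma> * sqrt pi * y * p)" unfolding SG by (rule ennreal_leI)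
      also have "\<dots> = ennreal (\<sigma> * sqrt pi * y) * P"
        using cpos ynn by (simp add: ennreal_mult' pP[symmetric])
      also have "\<dots> \<le> ennreal (\<sigma> * sqrt pi * y) * C_const \<sigma> \<beta>" using PC by (rule mult_left_mono) simp
      finally show ?thesis .
    qed
  qed
qed

end

section \<open>Phase synchronization\<close>

text \<open>|z| (sgn z - sgn w) = (z - w) + (|w| - |z|) sgn w, and each summand has modulus at most
  |z - w|. Only |z| appears as a weight; in the use below it is a product of values of f, which is
  bounded below.\<close>

lemma sgn_diff_le:
  fixes z w :: complex
  assumes "w \<noteq> 0"
  shows "cmod z * cmod (sgn z - sgn w) \<le> 2 * cmod (z - w)"
proof -
  have z: "of_real (cmod z) * sgn z = z" and w: "of_real (cmod w) * sgn w = w"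
    by (simp_all add: sgn_eq)
  have "of_real (cmod z) * (sgn z - sgn w) = (z - w) + of_real (cmod w - cmod z) * sgn w"
    using z w by (simp add: algebra_simps)
  then have "cmod z * cmod (sgn z - sgn w) = cmod ((z - w) + of_real (cmod w - cmod z) * sgn w)"
    by (metis abs_norm_cancel norm_mult norm_of_real)
  also have "\<dots> \<le> cmod (z - w) + \<bar>cmod w - cmod z\<bar>"
    using assms by (intro order_trans[OF norm_triangle_ineq]) (simp add: norm_mult norm_sgn flip: of_real_diff)
  also have "\<bar>cmod w - cmod z\<bar> \<le> cmod (z - w)"
    by (metis norm_minus_commute norm_triangle_ineq3)
  finally show ?thesis by simp
qed

text \<open>Here a, b are the values of f, g at a sample point and x, y those at a nearby point.
  Multiplying the first hypothesis by sgn a compares |a| x with |b| \<tau> y; replacing |b| by |a|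
  costs \<epsilon> / \<gamma> by the second one, and then |a| \<ge> \<gamma> is divided out.\<close>

lemma local_phase_estimate:
  fixes a b x y :: complex
  assumes "cmod (x * cnj a - y * cnj b) \<le> \<epsilon>" "cmod (a * cnj a - b * cnj b) \<le> \<epsilon>"
    and a: "\<gamma> \<le> cmod a" and "\<gamma> > 0" and b: "b \<noteq> 0" and y: "cmod y \<le> G"
  shows "cmod (x - sgn a * cnj (sgn b) * y) \<le> \<epsilon> / \<gamma> + \<epsilon> * G / \<gamma>\<^sup>2"
proof -
  have a0: "a \<noteq> 0" using a \<open>\<gamma> > 0\<close> by auto
  have nn: "\<epsilon> \<ge> 0" "G \<ge> 0" using assms(1) y norm_ge_zero order_trans by blast+
  let ?\<tau> = "sgn a * cnj (sgn b)"
  have sa: "sgn a * cnj (sgn a) = 1" using a0 by (simp add: complex_norm_square[symmetric] norm_sgn)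
  have ca: "cnj a = of_real (cmod a) * cnj (sgn a)" and cb: "cnj b = of_real (cmod b) * cnj (sgn b)"
    by (simp_all add: sgn_eq)
  have "of_real (cmod a) * x - of_real (cmod b) * ?\<tau> * y = sgn a * (x * cnj a - y * cnj b)"
    unfolding ca cb using sa by (simp add: algebra_simps)
  then have 1: "cmod (of_real (cmod a) * x - of_real (cmod b) * ?\<tau> * y) \<le> \<epsilon>"
    using assms(1) a0 by (simp add: norm_mult norm_sgn)
  have "a * cnj a - b * cnj b = of_real ((cmod a - cmod b) * (cmod a + cmod b))"
    by (simp add: complex_norm_square[symmetric] power2_eq_square algebra_simps flip: of_real_mult)
  then have "\<bar>cmod a - cmod b\<bar> * (cmod a + cmod b) \<le> \<epsilon>"
    using assms(2) by (simp only: norm_of_real abs_mult) simp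
  moreover have "\<bar>cmod a - cmod b\<bar> * \<gamma> \<le> \<bar>cmod a - cmod b\<bar> * (cmod a + cmod b)"
    using a by (intro mult_left_mono) (auto intro: add_increasing2)
  ultimately have 2: "\<bar>cmod b - cmod a\<bar> \<le> \<epsilon> / \<gamma>"
    using \<open>\<gamma> > 0\<close> by (simp add: field_simps abs_minus_commute)
  have n\<tau>: "cmod ?\<tau> = 1" using a0 b by (simp add: norm_mult norm_sgn)
  have "of_real (cmod a) * (x - ?\<tau> * y) = (of_real (cmod a) * x - of_real (cmod b) * ?\<tau> * y) + of_real (cmod b - cmod a) * ?\<tau> * y"
    by (simp add: algebra_simps)
  then have "cmod a * cmod (x - ?\<tau> * y) = cmod ((of_real (cmod a) * x - of_real (cmod b) * ?\<tau> * y) + of_real (cmod b - cmod a) * ?\<tau> * y)"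
    by (metis abs_norm_cancel norm_mult norm_of_real)
  also have "\<dots> \<le> \<epsilon> + \<bar>cmod b - cmod a\<bar> * cmod y"
    using 1 n\<tau> by (intro order_trans[OF norm_triangle_ineq] add_mono) (simp_all only: norm_mult norm_of_real mult_1_right order_refl)
  also have "\<dots> \<le> \<epsilon> + \<epsilon> / \<gamma> * G"
    using 2 y nn \<open>\<gamma> > 0\<close> by (intro add_left_mono mult_mono) auto
  finally have "cmod a * cmod (x - ?\<tau> * y) \<le> \<epsilon> + \<epsilon> / \<gamma> * G" .
  moreover have "\<gamma> * cmod (x - ?\<tau> * y) \<le> cmod a * cmod (x - ?\<tau> * y)" using a by (intro mult_right_mono) auto
  ultimately have "\<gamma> * cmod (x - ?\<tau> * y) \<le> \<epsilon> + \<epsilon> / \<gamma> * G" by linarith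
  then show ?thesis using \<open>\<gamma> > 0\<close> by (simp add: field_simps power2_eq_square)
qed

text \<open>The unimodular factor cnj (sgn a') sgn b turns the difference of the phases into sgn (a
  cnj a') - sgn (b cnj b'), to which \<open>sgn_diff_le\<close> applies with weight at least
  \<gamma>^2.\<close>

lemma adjacent_phase_estimate:
  fixes a b a' b' :: complex
  assumes "cmod (a * cnj a' - b * cnj b') \<le> \<epsilon>"
    and a: "\<gamma> \<le> cmod a" "\<gamma> \<le> cmod a'" and "\<gamma> > 0" and b: "b \<noteq> 0" "b' \<noteq> 0"
  shows "cmod (sgn a * cnj (sgn b) - sgn a' * cnj (sgn b')) \<le> 2 * \<epsilon> / \<gamma>\<^sup>2"
proof -
  have a0: "a \<noteq> 0" "a' \<noteq> 0" using a \<open>\<gamma> > 0\<close> by auto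
  have u: "sgn z * cnj (sgn z) = 1" if "z \<noteq> 0" for z :: complex
    using that by (simp add: complex_norm_square[symmetric] norm_sgn)
  let ?D = "sgn a * cnj (sgn b) - sgn a' * cnj (sgn b')"
  let ?z = "a * cnj a'" and ?w = "b * cnj b'"
  have sc: "sgn (cnj z) = cnj (sgn z)" for z by (simp add: sgn_eq)
  have "(cnj (sgn a') * sgn b) * ?D = sgn a * cnj (sgn a') * (sgn b * cnj (sgn b)) - (sgn a' * cnj (sgn a')) * (sgn b * cnj (sgn b'))"
    by (simp add: algebra_simps)
  also have "\<dots> = sgn ?z - sgn ?w"
    using u a0 b by (simp add: sgn_mult sc)
  finally have "cmod ?D = cmod (sgn ?z - sgn ?w)"
    using a0 b by (metis (no_types, lifting) complex_mod_cnj mult_1 norm_mult norm_sgn)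
  moreover have "cmod ?z * cmod (sgn ?z - sgn ?w) \<le> 2 * \<epsilon>"
    using sgn_diff_le[of ?w ?z] b assms(1) by auto
  moreover have "\<gamma>\<^sup>2 * cmod (sgn ?z - sgn ?w) \<le> cmod ?z * cmod (sgn ?z - sgn ?w)"
    using a \<open>\<gamma> > 0\<close> by (intro mult_right_mono) (auto simp: norm_mult power2_eq_square intro!: mult_mono)
  ultimately have "\<gamma>\<^sup>2 * cmod ?D \<le> 2 * \<epsilon>" by simp
  then show ?thesis using \<open>\<gamma> > 0\<close> by (simp add: field_simps)
qed

text \<open>The last sample point with p j \<le> t works, since either the next gap or the right
  margin is at most r. To the left of p 1 the margin suffices.\<close>

lemma near_sample_point:
  fixes p :: "nat \<Rightarrow> real"
  assumes "J \<ge> 1" and r: "\<And>j. j \<in> {1..J - 1} \<Longrightarrow> p (j + 1) - p j \<le> r"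
    and t: "p 1 - r \<le> t" "t \<le> p J + r" and "r \<ge> 0"
  shows "\<exists>j\<in>{1..J}. \<bar>t - p j\<bar> \<le> r"
proof (cases "p 1 \<le> t")
  case False
  then show ?thesis using assms by (intro bexI[of _ 1]) auto
next
  case True
  define j where "j = Max {j \<in> {1..J}. p j \<le> t}"
  have fin: "finite {j \<in> {1..J}. p j \<le> t}" by simp
  have ne: "{j \<in> {1..J}. p j \<le> t} \<noteq> {}" using True assms(1) by auto
  have j: "j \<in> {1..J}" "p j \<le> t" using Max_in[OF fin ne] by (auto simp: j_def)
  show ?thesis
  proof (cases "j = J")
    case True
    then show ?thesis using j t by (intro bexI[of _ j]) auto
  next
    case False
    have "\<not> p (j + 1) \<le> t"
    proof
      assume "p (j + 1) \<le> t"
      then have "j + 1 \<in> {j \<in> {1..J}. p j \<le> t}" using j False by auto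
      then have "j + 1 \<le> j" using Max_ge[OF fin, of "j + 1"] unfolding j_def[symmetric] by blast
      then show False by simp
    qed
    moreover have "j \<in> {1..J - 1}" using j False by auto
    ultimately show ?thesis using j r[of j] by (intro bexI[of _ j]) auto
  qed
qed

lemma global_phase:
  fixes f g :: "real \<Rightarrow> complex" and p :: "nat \<Rightarrow> real" and \<epsilon> F G :: real
  assumes J: "J \<ge> 2" and r: "\<And>j. j \<in> {1..J - 1} \<Longrightarrow> \<bar>p (j + 1) - p j\<bar> \<le> r" and "r \<ge> 0"
    and \<gamma>: "\<gamma> > 0" "\<And>j. j \<in> {1..J} \<Longrightarrow> \<gamma> \<le> cmod (f (p j))"
    and F: "\<And>t. t \<in> {p 1 - r..p J + r} \<Longrightarrow> cmod (f t) \<le> F"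
    and G: "\<And>t. t \<in> {p 1 - r..p J + r} \<Longrightarrow> cmod (g t) \<le> G"
    and FG: "F \<ge> 0" "G \<ge> 0"
    and \<epsilon>: "\<And>s t. \<bar>s - t\<bar> \<le> r \<Longrightarrow> cmod (f s * cnj (f t) - g s * cnj (g t)) \<le> \<epsilon>"
  shows "\<exists>\<tau>. cmod \<tau> = 1 \<and> (\<forall>t\<in>{p 1 - r..p J + r}.
    cmod (f t - \<tau> * g t) \<le> (2 + 2 * real (J div 2)) * (max 1 (F + G) / min \<gamma> (\<gamma>\<^sup>2)) * \<epsilon>)"
proof -
  define X where "X = max 1 (F + G)"
  define m where "m = min \<gamma> (\<gamma>\<^sup>2)"
  have m: "m > 0" "m \<le> \<gamma>" "m \<le> \<gamma>\<^sup>2" using \<gamma>(1) by (auto simp: m_def)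
  have X: "X \<ge> 1" "X \<ge> F + G" by (auto simp: X_def)
  have \<epsilon>0: "\<epsilon> \<ge> 0" using order_trans[OF norm_ge_zero \<epsilon>[of 0 0]] \<open>r \<ge> 0\<close> by simp
  have q1: "\<epsilon> / \<gamma> \<le> \<epsilon> / m" "\<epsilon> / \<gamma>\<^sup>2 \<le> \<epsilon> / m" using m \<epsilon>0 \<gamma>(1) by (auto intro!: divide_left_mono)
  have em: "\<epsilon> / m \<ge> 0" using \<epsilon>0 m by simp
  show ?thesis unfolding X_def[symmetric] m_def[symmetric]
  proof (cases "\<epsilon> \<ge> \<gamma>\<^sup>2")
    \<comment> \<open>Here \<epsilon> / m \<ge> 1, so the trivial bound |f| + |g| \<le> X is already
      small enough and \<tau> = 1 serves.\<close>
    case True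
    then have "1 \<le> \<epsilon> / m" using m by simp
    have "cmod (f t - 1 * g t) \<le> (2 + 2 * real (J div 2)) * (X / m) * \<epsilon>" if "t \<in> {p 1 - r..p J + r}" for t
    proof -
      have "cmod (f t - 1 * g t) \<le> cmod (f t) + cmod (g t)" using norm_triangle_ineq4 by simp
      also have "\<dots> \<le> X" using F[OF that] G[OF that] X by linarith
      also have "\<dots> = 1 * (X * 1)" by simp
      also have "\<dots> \<le> (2 + 2 * real (J div 2)) * (X * (\<epsilon> / m))"
        using \<open>1 \<le> \<epsilon> / m\<close> X by (intro mult_mono) auto
      finally show ?thesis by simp
    qed
    then show "\<exists>\<tau>. cmod \<tau> = 1 \<and> (\<forall>t\<in>{p 1 - r..p J + r}. cmod (f t - \<tau> * g t) \<le> (2 + 2 * real (J div 2)) * (X / m) * \<epsilon>)"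
      by (intro exI[of _ 1]) auto
  next
    case False
    \<comment> \<open>A zero of g at p j would force \<gamma>^2 \<le> |f (p j)|^2 \<le>
      \<epsilon>.\<close>
    have g0: "g (p j) \<noteq> 0" if "j \<in> {1..J}" for j
    proof
      assume "g (p j) = 0"
      then have "(cmod (f (p j)))\<^sup>2 \<le> \<epsilon>" using \<epsilon>[of "p j" "p j"] \<open>r \<ge> 0\<close> by (simp add: norm_mult power2_eq_square)
      moreover have "\<gamma>\<^sup>2 \<le> (cmod (f (p j)))\<^sup>2" using \<gamma>(1) \<gamma>(2)[OF that] by (intro power_mono) auto
      ultimately show False using False by linarith
    qed
    define \<tau> where "\<tau> j = sgn (f (p j)) * cnj (sgn (g (p j)))" for j
    have f0: "f (p j) \<noteq> 0" if "j \<in> {1..J}" for j using \<gamma>(1) \<gamma>(2)[OF that] by auto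
    have n\<tau>: "cmod (\<tau> j) = 1" if "j \<in> {1..J}" for j
      using f0[OF that] g0[OF that] by (simp add: \<tau>_def norm_mult norm_sgn)
    have step: "cmod (\<tau> j - \<tau> (Suc j)) \<le> 2 * \<epsilon> / \<gamma>\<^sup>2" if "j \<in> {1..J - 1}" for j
      unfolding \<tau>_def
    proof (rule adjacent_phase_estimate)
      have j: "j \<in> {1..J}" "Suc j \<in> {1..J}" using that by auto
      show "cmod (f (p j) * cnj (f (p (Suc j))) - g (p j) * cnj (g (p (Suc j)))) \<le> \<epsilon>"
        using r[OF that] by (intro \<epsilon>) (simp add: abs_minus_commute)
    qed (use that \<gamma> g0 in auto)
    have chain: "cmod (\<tau> i - \<tau> (i + n)) \<le> real n * (2 * \<epsilon> / \<gamma>\<^sup>2)" if "1 \<le> i" "i + n \<le> J" for i n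
      using that(2)
    proof (induction n)
      case (Suc n)
      have "cmod (\<tau> i - \<tau> (i + Suc n)) \<le> cmod (\<tau> i - \<tau> (i + n)) + cmod (\<tau> (i + n) - \<tau> (Suc (i + n)))"
        using norm_triangle_ineq[of "\<tau> i - \<tau> (i + n)" "\<tau> (i + n) - \<tau> (Suc (i + n))"] by simp
      also have "\<dots> \<le> real n * (2 * \<epsilon> / \<gamma>\<^sup>2) + 2 * \<epsilon> / \<gamma>\<^sup>2"
        using Suc that(1) by (intro add_mono step) auto
      also have "\<dots> = real (Suc n) * (2 * \<epsilon> / \<gamma>\<^sup>2)"
        by (simp only: of_nat_Suc distrib_right mult_1_left add.commute)
      finally show ?case .
    qed simp
    \<comment> \<open>The middle index, rounded up: at most J div 2 steps separate it from either
      end.\<close>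
    define c where "c = J - J div 2"
    have c: "c \<in> {1..J}" using J by (auto simp: c_def)
    have to_c: "cmod (\<tau> j - \<tau> c) \<le> real (J div 2) * (2 * \<epsilon> / \<gamma>\<^sup>2)" if j: "j \<in> {1..J}" for j
    proof -
      have *: "real n * (2 * \<epsilon> / \<gamma>\<^sup>2) \<le> real (J div 2) * (2 * \<epsilon> / \<gamma>\<^sup>2)" if "n \<le> J div 2" for n
        using that \<epsilon>0 by (intro mult_right_mono) auto
      show ?thesis
      proof (cases "j \<le> c")
        case True
        have "c - j \<le> J div 2" using j by (auto simp: c_def)
        then show ?thesis using chain[of j "c - j"] *[of "c - j"] True j c by auto
      next
        case False
        have "j - c \<le> J div 2" using j by (auto simp: c_def)
        then show ?thesis using chain[of c "j - c"] *[of "j - c"] False j c by (auto simp: norm_minus_commute)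
      qed
    qed
    have "cmod (f t - \<tau> c * g t) \<le> (2 + 2 * real (J div 2)) * (X / m) * \<epsilon>" if t: "t \<in> {p 1 - r..p J + r}" for t
    proof -
      have "\<exists>j\<in>{1..J}. \<bar>t - p j\<bar> \<le> r"
        by (rule near_sample_point) (use J t r \<open>r \<ge> 0\<close> in \<open>auto simp: abs_le_iff\<close>)
      then obtain j where j: "j \<in> {1..J}" "\<bar>t - p j\<bar> \<le> r" by blast
      have "cmod (f t - \<tau> j * g t) \<le> \<epsilon> / \<gamma> + \<epsilon> * G / \<gamma>\<^sup>2"
        unfolding \<tau>_def by (rule local_phase_estimate) (use j \<epsilon> \<gamma> g0 G[OF t] \<open>r \<ge> 0\<close> in auto)
      also have "\<dots> = \<epsilon> / \<gamma> + \<epsilon> / \<gamma>\<^sup>2 * G" by simp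
      also have "\<dots> \<le> \<epsilon> / m + \<epsilon> / m * G" using q1 FG by (intro add_mono mult_right_mono) auto
      also have "\<dots> = (1 + G) * (\<epsilon> / m)" by (simp only: distrib_right mult_1_left mult.commute)
      \<comment> \<open>Both 1 and G are at most X; this is the summand 2 in 2 + 2 (J div 2), the
        rest coming from the chain of phases.\<close>
      also have "\<dots> \<le> (2 * X) * (\<epsilon> / m)" using X FG em by (intro mult_right_mono) auto
      finally have 1: "cmod (f t - \<tau> j * g t) \<le> 2 * X * (\<epsilon> / m)" .
      have "cmod ((\<tau> j - \<tau> c) * g t) \<le> (real (J div 2) * (2 * \<epsilon> / \<gamma>\<^sup>2)) * G"
        unfolding norm_mult using to_c[OF j(1)] G[OF t] \<epsilon>0 by (intro mult_mono) auto
      also have "\<dots> = real (J div 2) * 2 * (\<epsilon> / \<gamma>\<^sup>2) * G" by simp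
      also have "\<dots> \<le> real (J div 2) * 2 * (\<epsilon> / m) * X"
        using q1 FG X em \<epsilon>0 m(1) by (intro mult_mono mult_left_mono) auto
      finally have 2: "cmod ((\<tau> j - \<tau> c) * g t) \<le> real (J div 2) * 2 * (\<epsilon> / m) * X" .
      have "f t - \<tau> c * g t = (f t - \<tau> j * g t) + (\<tau> j - \<tau> c) * g t" by (simp add: algebra_simps)
      then have "cmod (f t - \<tau> c * g t) \<le> cmod (f t - \<tau> j * g t) + cmod ((\<tau> j - \<tau> c) * g t)"
        using norm_triangle_ineq by metis
      also have "\<dots> \<le> 2 * X * (\<epsilon> / m) + real (J div 2) * 2 * (\<epsilon> / m) * X" using 1 2 by linarith
      also have "\<dots> = (2 + 2 * real (J div 2)) * (X / m) * \<epsilon>" using m by (simp add: field_simps)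
      finally show ?thesis .
    qed
    then show "\<exists>\<tau>. cmod \<tau> = 1 \<and> (\<forall>t\<in>{p 1 - r..p J + r}. cmod (f t - \<tau> * g t) \<le> (2 + 2 * real (J div 2)) * (X / m) * \<epsilon>)"
      using n\<tau>[OF c] by blast
  qed
qed

section \<open>The supremum norm of continuous functions\<close>

lemma Linf_norm_le:
  assumes "continuous_on UNIV f" and "I \<in> sets borel" and "\<And>t. t \<in> I \<Longrightarrow> ennreal (cmod (f t)) \<le> B"
  shows "Linf_norm I f \<le> B"
  unfolding Linf_norm_def
proof (rule esssup_I)
  note borel_measurable_continuous_onI[OF assms(1), measurable]
  show "(\<lambda>t. ennreal (cmod (f t))) \<in> borel_measurable (restrict_space lborel I)"
    by (intro measurable_restrict_space1) measurable
  show "AE t in restrict_space lborel I. ennreal (cmod (f t)) \<le> B"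
    using assms(3) by (intro AE_I2) (auto simp: space_restrict_space)
qed

text \<open>By continuity, a value above the essential supremum persists on an interval around t. As
  a < b, its part inside {a..b} has positive length even if t is an endpoint.\<close>

lemma le_Linf_norm:
  fixes a b t :: real
  assumes f: "continuous_on UNIV f" and ab: "a < b" and t: "t \<in> {a..b}"
  shows "ennreal (cmod (f t)) \<le> Linf_norm {a..b} f"
proof (rule ccontr)
  let ?L = "Linf_norm {a..b} f"
  assume "\<not> ennreal (cmod (f t)) \<le> ?L"
  then have lt: "?L < ennreal (cmod (f t))" by simp
  then obtain l where l: "?L = ennreal l" "l \<ge> 0" by (cases ?L) auto
  have "l < cmod (f t)" using lt l by (simp add: ennreal_less_iff)
  have "continuous (at t) (\<lambda>x. cmod (f x))" using f by (intro continuous_norm) (simp add: continuous_on_eq_continuous_at)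
  then have "\<forall>\<^sub>F x in at t. l < cmod (f x)" using \<open>l < cmod (f t)\<close> by (metis isCont_def order_tendstoD(1))
  then obtain \<delta> where \<delta>: "\<delta> > 0" "\<And>x. dist x t < \<delta> \<Longrightarrow> l < cmod (f x)"
    using \<open>l < cmod (f t)\<close> unfolding eventually_at by (metis UNIV_I)
  define lo hi where "lo = max a (t - \<delta>)" and "hi = min b (t + \<delta>)"
  have lh: "lo < hi" using ab t \<delta>(1) by (auto simp: lo_def hi_def)
  have "AE x in restrict_space lborel {a..b}. ennreal (cmod (f x)) \<le> ?L"
    unfolding Linf_norm_def by (rule esssup_AE)
  then have "AE x in lborel. x \<in> {a..b} \<longrightarrow> cmod (f x) \<le> l"
    using l by (simp add: AE_restrict_space_iff ennreal_le_iff)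
  then have "AE x in lborel. x \<notin> {lo<..<hi}"
  proof eventually_elim
    case (elim x)
    show ?case
    proof
      assume "x \<in> {lo<..<hi}"
      then have "x \<in> {a..b}" "dist x t < \<delta>" by (auto simp: lo_def hi_def dist_real_def)
      then show False using elim \<delta>(2)[of x] by auto
    qed
  qed
  then have "emeasure lborel {lo<..<hi} = 0"
    by (subst (asm) AE_iff_measurable[of "{lo<..<hi}"]) auto
  then show False using lh by simp
qed

lemma Linf_norm_finite:
  fixes a b :: real
  assumes f: "continuous_on UNIV f"
  obtains B where "B \<ge> 0" "Linf_norm {a..b} f = ennreal B"
proof -
  have "compact (f ` {a..b})" using continuous_on_subset[OF f] by (intro compact_continuous_image) auto
  then obtain K where "\<And>t. t \<in> {a..b} \<Longrightarrow> cmod (f t) \<le> K" using compact_imp_bounded by (fastforce simp: bounded_iff)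
  then have "Linf_norm {a..b} f \<le> ennreal K" by (intro Linf_norm_le f) (auto intro: ennreal_leI)
  then have "Linf_norm {a..b} f \<noteq> \<infinity>" by (auto simp: top_unique)
  then show thesis using that[of "enn2real (Linf_norm {a..b} f)"] by (simp add: less_top)
qed

text \<open>The norm is Lipschitz in \<tau>, with the supremum norm of g as constant, and the unit
  circle is compact.\<close>

lemma Linf_norm_arg_min_exists:
  fixes a b :: real
  assumes f: "continuous_on UNIV f" and g: "continuous_on UNIV g" and ab: "a < b"
  shows "\<exists>\<tau>. is_arg_min (\<lambda>\<tau>. Linf_norm {a..b} (\<lambda>t. f t - \<tau> * g t)) (\<lambda>\<tau>. cmod \<tau> = 1) \<tau>"
proof -
  let ?h = "\<lambda>\<tau> t. f t - \<tau> * g t"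
  have h: "continuous_on UNIV (?h \<tau>)" for \<tau> by (intro continuous_intros f g)
  obtain N where N: "N \<ge> 0" "Linf_norm {a..b} g = ennreal N" using Linf_norm_finite[OF g] by blast
  define L where "L \<tau> = enn2real (Linf_norm {a..b} (?h \<tau>))" for \<tau>
  have L: "Linf_norm {a..b} (?h \<tau>) = ennreal (L \<tau>)" and L0: "L \<tau> \<ge> 0" for \<tau>
  proof -
    obtain B where "B \<ge> 0" "Linf_norm {a..b} (?h \<tau>) = ennreal B" using Linf_norm_finite[OF h] by blast
    then show "Linf_norm {a..b} (?h \<tau>) = ennreal (L \<tau>)" "L \<tau> \<ge> 0" by (simp_all add: L_def)
  qed
  have lip: "L \<tau> \<le> L \<tau>' + N * cmod (\<tau> - \<tau>')" for \<tau> \<tau>'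
  proof -
    have "Linf_norm {a..b} (?h \<tau>) \<le> ennreal (L \<tau>' + N * cmod (\<tau> - \<tau>'))"
    proof (intro Linf_norm_le h ennreal_leI)
      fix t assume t: "t \<in> {a..b}"
      have "cmod (?h \<tau>' t) \<le> L \<tau>'" using le_Linf_norm[OF h ab t, of \<tau>'] L0 by (simp add: L ennreal_le_iff)
      moreover have "cmod (g t) \<le> N" using le_Linf_norm[OF g ab t] N by (simp add: ennreal_le_iff)
      moreover have "cmod (?h \<tau> t) \<le> cmod (?h \<tau>' t) + cmod (g t) * cmod (\<tau> - \<tau>')"
      proof -
        have "?h \<tau> t = ?h \<tau>' t - g t * (\<tau> - \<tau>')" by (simp add: algebra_simps)
        then show ?thesis by (metis norm_mult norm_triangle_ineq4)
      qed
      ultimately show "cmod (?h \<tau> t) \<le> L \<tau>' + N * cmod (\<tau> - \<tau>')"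
        by (smt (verit) mult_right_mono norm_ge_zero)
    qed simp
    moreover have "0 \<le> L \<tau>' + N * cmod (\<tau> - \<tau>')" using L0 N(1) by simp
    ultimately show ?thesis by (simp only: L ennreal_le_iff)
  qed
  have "N-lipschitz_on (sphere 0 1) L"
  proof (rule lipschitz_onI)
    show "dist (L x) (L y) \<le> N * dist x y" for x y
      using lip[of x y] lip[of y x] by (simp add: dist_real_def dist_norm norm_minus_commute)
  qed fact
  then have "continuous_on (sphere 0 1) L" by (rule lipschitz_on_continuous_on)
  then obtain \<tau> where \<tau>: "\<tau> \<in> sphere 0 1" "\<And>\<tau>'. \<tau>' \<in> sphere 0 1 \<Longrightarrow> L \<tau> \<le> L \<tau>'"
    using continuous_attains_inf[of "sphere 0 1 :: complex set" L] by (auto simp: sphere_empty)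
  then have "is_arg_min (\<lambda>\<tau>. Linf_norm {a..b} (?h \<tau>)) (\<lambda>\<tau>. cmod \<tau> = 1) \<tau>"
    by (auto simp: is_arg_min_def L L0 ennreal_less_iff not_less)
  then show ?thesis by blast
qed

section \<open>The stability estimate\<close>

text \<open>The conjugated chirp of the window cancels the t^2 term of the kernel. What depends on t
  is then a pure frequency (\<xi> - a x) / b, and the root in the kernel contributes 1 / b to the
  square.\<close>

lemma STLCT_chirped_gauss:
  assumes b: "A $ 1 $ 2 > 0"
  shows "(cmod (STLCT A (chirped_gauss \<sigma> A) f x \<xi>))\<^sup>2 =
    1 / A $ 1 $ 2 * (cmod (gabor \<sigma> f x ((\<xi> - A $ 1 $ 1 * x) / A $ 1 $ 2)))\<^sup>2"
proof -
  define a b d where "a = A $ 1 $ 1" and "b = A $ 1 $ 2" and "d = A $ 2 $ 2"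
  have b: "b > 0" using assms by (simp add: b_def)
  define \<kappa> where "\<kappa> = 1 / csqrt (\<i> * of_real b) * exp (\<i> * of_real (pi / b * (d * \<xi>\<^sup>2 - a * x\<^sup>2)))"
  have n\<kappa>: "(cmod \<kappa>)\<^sup>2 = 1 / b"
    using b by (simp add: \<kappa>_def norm_mult norm_divide power_divide norm_csqrt)
  have "f t * cnj (chirped_gauss \<sigma> A (t - x)) * lct_kernel A \<xi> t
     = \<kappa> * (f t * gauss \<sigma> (t - x) * exp (\<i> * of_real (- 2 * pi * ((\<xi> - a * x) / b) * t)))" for t
  proof -
    have c: "cnj (chirped_gauss \<sigma> A (t - x)) = exp (\<i> * of_real (- (pi * (a / b) * (t - x)\<^sup>2))) * gauss \<sigma> (t - x)"
      by (simp add: chirped_gauss_def gauss_def exp_cnj a_def b_def)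
    have "- (pi * (a / b) * (t - x)\<^sup>2) + pi / b * (a * t\<^sup>2 - 2 * \<xi> * t + d * \<xi>\<^sup>2)
      = pi / b * (d * \<xi>\<^sup>2 - a * x\<^sup>2) + - 2 * pi * ((\<xi> - a * x) / b) * t"
      using b by (simp add: field_simps power2_eq_square)
    then have e: "exp (\<i> * of_real (- (pi * (a / b) * (t - x)\<^sup>2))) * exp (\<i> * of_real (pi / b * (a * t\<^sup>2 - 2 * \<xi> * t + d * \<xi>\<^sup>2)))
      = exp (\<i> * of_real (pi / b * (d * \<xi>\<^sup>2 - a * x\<^sup>2))) * exp (\<i> * of_real (- 2 * pi * ((\<xi> - a * x) / b) * t))"
      unfolding exp_add[symmetric] distrib_left[symmetric] of_real_add[symmetric] by (simp only:)
    have "f t * cnj (chirped_gauss \<sigma> A (t - x)) * lct_kernel A \<xi> t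
      = f t * gauss \<sigma> (t - x) * (1 / csqrt (\<i> * of_real b)) *
        (exp (\<i> * of_real (- (pi * (a / b) * (t - x)\<^sup>2))) * exp (\<i> * of_real (pi / b * (a * t\<^sup>2 - 2 * \<xi> * t + d * \<xi>\<^sup>2))))"
      unfolding c lct_kernel_def a_def b_def d_def by (simp only: mult_ac)
    then show ?thesis unfolding e \<kappa>_def by (simp only: mult_ac)
  qed
  then have "STLCT A (chirped_gauss \<sigma> A) f x \<xi> = \<kappa> * gabor \<sigma> f x ((\<xi> - a * x) / b)"
    unfolding STLCT_def gabor_def by (simp only: Bochner_Integration.integral_mult_right_zero)
  then show ?thesis using n\<kappa> by (simp add: norm_mult power_mult_distrib a_def b_def)
qed

text \<open>Read off from \<open>gabor_autocorrelation\<close> at lag 0, because integrability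
  includes measurability.\<close>

lemma gabor_square_measurable:
  assumes "\<sigma> > 0" "\<beta> > 0" "f \<in> gauss_SIS \<sigma> \<beta>"
  shows "(\<lambda>\<eta>. (cmod (gabor \<sigma> f (\<beta> / 2 * of_int n) \<eta>))\<^sup>2) \<in> borel_measurable borel"
proof -
  obtain c where c: "bounded (range c)"
    "\<And>t. ((\<lambda>k. c k * gauss \<sigma> (t - \<beta> * of_int k)) has_sum f t) UNIV"
    using assms(3) unfolding gauss_SIS_def by auto
  have "integrable lborel (\<lambda>\<eta>. complex_of_real ((cmod (gabor \<sigma> f (\<beta> / 2 * of_int n) \<eta>))\<^sup>2) * exp (\<i> * of_real (2 * pi * 0 * \<eta>)))"
    by (rule gabor_autocorrelation(1)[OF assms(1,2) c])
  then have "integrable lborel (\<lambda>\<eta>. complex_of_real ((cmod (gabor \<sigma> f (\<beta> / 2 * of_int n) \<eta>))\<^sup>2))"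
    by simp
  then have "integrable lborel (\<lambda>\<eta>. (cmod (gabor \<sigma> f (\<beta> / 2 * of_int n) \<eta>))\<^sup>2)"
    by (simp only: complex_of_real_integrable_eq)
  then show ?thesis using borel_measurable_integrable by fastforce
qed

text \<open>The substitution \<xi> = a x + b \<eta> has Jacobian b, which cancels the 1 / b of
  \<open>STLCT_chirped_gauss\<close>. This is how the matrix disappears from the estimate.\<close>

lemma gabor_spectrogram_diff_le:
  assumes \<sigma>: "\<sigma> > 0" and \<beta>: "\<beta> > 0" and fg: "f \<in> gauss_SIS \<sigma> \<beta>" "g \<in> gauss_SIS \<sigma> \<beta>"
    and b: "A $ 1 $ 2 > 0"
  shows "(\<integral>\<^sup>+\<eta>. ennreal \<bar>(cmod (gabor \<sigma> f (\<beta> / 2 * of_int n) \<eta>))\<^sup>2 - (cmod (gabor \<sigma> g (\<beta> / 2 * of_int n) \<eta>))\<^sup>2\<bar> \<partial>lborel)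
    \<le> mixed_norm (\<beta> / 2) (\<lambda>x \<xi>. (cmod (STLCT A (chirped_gauss \<sigma> A) f x \<xi>))\<^sup>2 - (cmod (STLCT A (chirped_gauss \<sigma> A) g x \<xi>))\<^sup>2)"
proof -
  let ?b = "A $ 1 $ 2" and ?a = "A $ 1 $ 1" and ?x = "\<beta> / 2 * of_int n"
  let ?H = "\<lambda>\<eta>. \<bar>(cmod (gabor \<sigma> f ?x \<eta>))\<^sup>2 - (cmod (gabor \<sigma> g ?x \<eta>))\<^sup>2\<bar>"
  have meas [measurable]: "?H \<in> borel_measurable borel"
    using gabor_square_measurable[OF \<sigma> \<beta> fg(1)] gabor_square_measurable[OF \<sigma> \<beta> fg(2)] by measurable
  have "(\<integral>\<^sup>+\<xi>. ennreal (norm ((cmod (STLCT A (chirped_gauss \<sigma> A) f ?x \<xi>))\<^sup>2 - (cmod (STLCT A (chirped_gauss \<sigma> A) g ?x \<xi>))\<^sup>2)) \<partial>lborel)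
     = (\<integral>\<^sup>+\<xi>. ennreal (1 / ?b) * ennreal (?H ((\<xi> - ?a * ?x) / ?b)) \<partial>lborel)"
  proof (rule nn_integral_cong)
    fix \<xi>
    define P Q where "P = (cmod (gabor \<sigma> f ?x ((\<xi> - ?a * ?x) / ?b)))\<^sup>2"
      and "Q = (cmod (gabor \<sigma> g ?x ((\<xi> - ?a * ?x) / ?b)))\<^sup>2"
    have "norm (1 / ?b * P - 1 / ?b * Q) = 1 / ?b * \<bar>P - Q\<bar>"
      using b by (simp add: abs_mult flip: diff_divide_distrib)
    then show "ennreal (norm ((cmod (STLCT A (chirped_gauss \<sigma> A) f ?x \<xi>))\<^sup>2 - (cmod (STLCT A (chirped_gauss \<sigma> A) g ?x \<xi>))\<^sup>2))
        = ennreal (1 / ?b) * ennreal (?H ((\<xi> - ?a * ?x) / ?b))"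
      unfolding STLCT_chirped_gauss[OF b] P_def[symmetric] Q_def[symmetric]
      using b by (simp only:) (rule ennreal_mult, auto)
  qed
  also have "\<dots> = ennreal (1 / ?b) * (\<integral>\<^sup>+\<xi>. ennreal (?H ((\<xi> - ?a * ?x) / ?b)) \<partial>lborel)"
    by (rule nn_integral_cmult) measurable
  also have "(\<integral>\<^sup>+\<xi>. ennreal (?H ((\<xi> - ?a * ?x) / ?b)) \<partial>lborel)
      = \<bar>?b\<bar> * (\<integral>\<^sup>+\<eta>. ennreal (?H (((?a * ?x + ?b * \<eta>) - ?a * ?x) / ?b)) \<partial>lborel)"
    by (rule nn_integral_real_affine) (use b in \<open>measurable, auto\<close>)
  also have "\<dots> = ennreal ?b * (\<integral>\<^sup>+\<eta>. ennreal (?H \<eta>) \<partial>lborel)"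
    using b by simp
  finally have "(\<integral>\<^sup>+\<eta>. ennreal (?H \<eta>) \<partial>lborel)
    = (\<integral>\<^sup>+\<xi>. ennreal (norm ((cmod (STLCT A (chirped_gauss \<sigma> A) f ?x \<xi>))\<^sup>2 - (cmod (STLCT A (chirped_gauss \<sigma> A) g ?x \<xi>))\<^sup>2)) \<partial>lborel)"
    using b by (simp add: mult.assoc[symmetric] ennreal_mult[symmetric])
  then show ?thesis
    unfolding mixed_norm_def by (simp only:) (rule SUP_upper, simp)
qed

text \<open>Prevents 0 * \<infinity> when the mixed norm is infinite. The unit sequence at s = 0 has
  G = 1 and data bounded by 1, so \<open>deconvolution_bound\<close> would read 1 \<le> 0.\<close>

lemma C_const_nonzero:
  assumes \<sigma>: "\<sigma> > 0" and \<beta>: "\<beta> > 0"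
  shows "C_const \<sigma> \<beta> \<noteq> 0"
proof
  assume C: "C_const \<sigma> \<beta> = 0"
  define q where "q = exp (- \<beta>\<^sup>2 / (8 * \<sigma>\<^sup>2))"
  define d :: "int \<Rightarrow> complex" where "d m = (if m = 0 then 1 else 0)" for m
  have "ennreal (cmod 1) \<le> ennreal (\<sigma> * sqrt pi * 1) * C_const \<sigma> \<beta>"
  proof (rule deconvolution_bound[OF \<sigma> \<beta> q_def, where d = d and s = 0 and Y = "\<lambda>n. of_real (q powi ((0 - n)\<^sup>2))"])
    show "bounded (range d)" by (auto simp: bounded_iff d_def intro: exI[of _ 1])
    show "((\<lambda>m. d m * of_real (exp (- (1 / \<sigma>\<^sup>2) * (0 - \<beta> / 2 * of_int m)\<^sup>2))) has_sum 1) UNIV"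
      by (rule has_sum_finite_neutralI[of "{0}"]) (auto simp: d_def)
    show "((\<lambda>m. d m * of_real (q powi ((m - n)\<^sup>2))) has_sum of_real (q powi ((0 - n)\<^sup>2))) UNIV" for n
      by (rule has_sum_finite_neutralI[of "{0}"]) (auto simp: d_def)
    show "cmod (of_real (q powi ((0 - n)\<^sup>2))) \<le> 1" for n
    proof -
      have "q powi ((0 - n)\<^sup>2) = q ^ nat ((0 - n)\<^sup>2)" by (simp add: power_int_def)
      then show ?thesis using theta_nome_bounds[OF \<sigma> \<beta> q_def] by (simp add: norm_power power_le_one)
    qed
  qed
  then show False by (simp add: C)
qed

text \<open>Deconvolution is linear in the coefficients, so at lag u = x - y and midpoint s it
  applies to the difference of those of f and g.\<close>

lemma bilinear_estimate:
  assumes \<sigma>: "\<sigma> > 0" and \<beta>: "\<beta> > 0" and f: "f \<in> gauss_SIS \<sigma> \<beta>" and g: "g \<in> gauss_SIS \<sigma> \<beta>"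
    and b: "A $ 1 $ 2 > 0"
  shows "ennreal (cmod (f x * cnj (f y) - g x * cnj (g y))) \<le>
    ennreal (sqrt 2 * exp ((x - y)\<^sup>2 / (4 * \<sigma>\<^sup>2))) * C_const \<sigma> \<beta> *
    mixed_norm (\<beta> / 2) (\<lambda>x \<xi>. (cmod (STLCT A (chirped_gauss \<sigma> A) f x \<xi>))\<^sup>2 - (cmod (STLCT A (chirped_gauss \<sigma> A) g x \<xi>))\<^sup>2)"
    (is "_ \<le> _ * _ * ?M")
proof (cases "?M = \<infinity>")
  case True
  have "ennreal (sqrt 2 * exp ((x - y)\<^sup>2 / (4 * \<sigma>\<^sup>2))) * C_const \<sigma> \<beta> \<noteq> 0"
    using C_const_nonzero[OF \<sigma> \<beta>] by simp
  then show ?thesis unfolding True by (simp add: ennreal_mult_top)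
next
  case False
  then obtain M where M: "?M = ennreal M" "M \<ge> 0" by (cases ?M) auto
  define u where "u = x - y"
  define s where "s = (x + y) / 2"
  have xy: "x = s + u / 2" "y = s - u / 2" by (simp_all add: s_def u_def field_simps)
  define q where "q = exp (- \<beta>\<^sup>2 / (8 * \<sigma>\<^sup>2))"
  define \<kappa> where "\<kappa> = exp (u\<^sup>2 / (4 * \<sigma>\<^sup>2)) / (\<sigma> * sqrt (pi / 2))"
  have \<kappa>: "\<kappa> > 0" using \<sigma> by (simp add: \<kappa>_def)
  obtain c where c: "bounded (range c)" "\<And>t. ((\<lambda>k. c k * gauss \<sigma> (t - \<beta> * of_int k)) has_sum f t) UNIV"
    using f unfolding gauss_SIS_def by auto
  obtain e where e: "bounded (range e)" "\<And>t. ((\<lambda>k. e k * gauss \<sigma> (t - \<beta> * of_int k)) has_sum g t) UNIV"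
    using g unfolding gauss_SIS_def by auto
  define d where "d m = diag_coeff \<sigma> \<beta> u c m - diag_coeff \<sigma> \<beta> u e m" for m
  let ?F = "\<lambda>f n \<eta>. of_real ((cmod (gabor \<sigma> f (\<beta> / 2 * of_int n) \<eta>))\<^sup>2) * exp (\<i> * of_real (2 * pi * u * \<eta>)) :: complex"
  define Y where "Y n = of_real \<kappa> * (integral\<^sup>L lborel (?F f n) - integral\<^sup>L lborel (?F g n))" for n
  have diff: "((\<lambda>m. d m * W m) has_sum S - T) UNIV"
    if "((\<lambda>m. diag_coeff \<sigma> \<beta> u c m * W m) has_sum S) UNIV" "((\<lambda>m. diag_coeff \<sigma> \<beta> u e m * W m) has_sum T) UNIV" for W S T
    using has_sum_add[OF that(1) has_sum_uminusI[OF that(2)]] by (simp add: d_def algebra_simps)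
  have "ennreal (cmod (f x * cnj (f y) - g x * cnj (g y))) \<le> ennreal (\<sigma> * sqrt pi * (\<kappa> * M)) * C_const \<sigma> \<beta>"
  proof (rule deconvolution_bound[OF \<sigma> \<beta> q_def, where d = d and s = s and Y = Y])
    show "bounded (range d)"
    proof -
      have "bounded ((\<lambda>x. fst x - snd x) ` (range (diag_coeff \<sigma> \<beta> u c) \<times> range (diag_coeff \<sigma> \<beta> u e)))"
        using diag_coeff(1)[OF \<sigma> \<beta> c(1), of u] diag_coeff(1)[OF \<sigma> \<beta> e(1), of u] bounded_minus[of "range (diag_coeff \<sigma> \<beta> u c)" "range (diag_coeff \<sigma> \<beta> u e)"]
        by (simp add: case_prod_unfold)
      then show ?thesis by (rule bounded_subset) (force simp: d_def)
    qed
    show "((\<lambda>m. d m * of_real (exp (- (1 / \<sigma>\<^sup>2) * (s - \<beta> / 2 * of_int m)\<^sup>2))) has_sum f x * cnj (f y) - g x * cnj (g y)) UNIV"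
      unfolding xy by (rule diff[OF product_expansion[OF \<sigma> \<beta> c] product_expansion[OF \<sigma> \<beta> e]])
    show "((\<lambda>m. d m * of_real (q powi ((m - n)\<^sup>2))) has_sum Y n) UNIV" for n
      unfolding Y_def right_diff_distrib \<kappa>_def q_def
      by (rule diff[OF gabor_autocorrelation(2)[OF \<sigma> \<beta> c] gabor_autocorrelation(2)[OF \<sigma> \<beta> e]])
    show "cmod (Y n) \<le> \<kappa> * M" for n
    proof -
      note int = gabor_autocorrelation(1)[OF \<sigma> \<beta> c, where u = u and n = n] gabor_autocorrelation(1)[OF \<sigma> \<beta> e, where u = u and n = n]
      let ?I = "integral\<^sup>L lborel (?F f n) - integral\<^sup>L lborel (?F g n)"
      have I: "?I = integral\<^sup>L lborel (\<lambda>\<eta>. ?F f n \<eta> - ?F g n \<eta>)"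
        by (rule Bochner_Integration.integral_diff[symmetric]) (rule int)+
      have n: "cmod (?F f n \<eta> - ?F g n \<eta>) = \<bar>(cmod (gabor \<sigma> f (\<beta> / 2 * of_int n) \<eta>))\<^sup>2 - (cmod (gabor \<sigma> g (\<beta> / 2 * of_int n) \<eta>))\<^sup>2\<bar>" for \<eta>
        unfolding left_diff_distrib[symmetric] of_real_diff[symmetric] norm_mult norm_of_real norm_exp_i_times by simp
      \<comment> \<open>The lag enters only through a unimodular factor, so one L^1 bound controls
        all lags.\<close>
      have "ennreal (cmod ?I) \<le> (\<integral>\<^sup>+\<eta>. ennreal (cmod (?F f n \<eta> - ?F g n \<eta>)) \<partial>lborel)"
        unfolding I by (rule integral_norm_bound_ennreal) (intro Bochner_Integration.integrable_diff int)
      also have "\<dots> \<le> ?M"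
        unfolding n by (rule gabor_spectrogram_diff_le[OF \<sigma> \<beta> f g b])
      finally have "cmod ?I \<le> M" using M by (simp add: ennreal_le_iff)
      then show ?thesis using \<kappa> by (simp add: Y_def norm_mult)
    qed
  qed
  \<comment> \<open>The sqrt 2 is the ratio of \<sigma> sqrt \<pi> to the \<sigma> sqrt (\<pi> / 2)
    in \<kappa>.\<close>
  also have "\<sigma> * sqrt pi * (\<kappa> * M) = sqrt 2 * exp ((x - y)\<^sup>2 / (4 * \<sigma>\<^sup>2)) * M"
    using \<sigma> by (simp add: \<kappa>_def u_def real_sqrt_divide)
  finally show ?thesis
    unfolding M(1) using M(2) by (simp add: ennreal_mult mult_ac)
qed

theorem theorem4p2:
  fixes \<sigma> \<beta> \<gamma> r :: real and A :: "real^2^2"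
    and f g :: "real \<Rightarrow> complex" and J :: nat and p :: "nat \<Rightarrow> real" and I :: "real set"
  assumes "\<sigma> > 0" and "\<beta> > 0"
    and "det A = 1" and "A $ 1 $ 2 > 0"
    and "f \<in> gauss_SIS \<sigma> \<beta>"
    and "J \<ge> 2"
    and "strict_mono_on {1..J} p"
    and "\<gamma> > 0" and "\<forall>j\<in>{1..J}. cmod (f (p j)) \<ge> \<gamma>"
    and "r = Max ((\<lambda>j. p (j + 1) - p j) ` {1..J - 1})"
    and "I = {p 1 - r .. p J + r}"
    and "g \<in> gauss_SIS \<sigma> \<beta>"
  shows "\<exists>\<tau>::complex.
    is_arg_min (\<lambda>\<tau>. Linf_norm I (\<lambda>t. f t - \<tau> * g t)) (\<lambda>\<tau>. cmod \<tau> = 1) \<tau> \<and>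
    Linf_norm I (\<lambda>t. f t - \<tau> * g t)
      \<le> ennreal (16 * sqrt 2 / 3 * of_int \<lceil>real J / 2\<rceil> * exp (r\<^sup>2 / (4 * \<sigma>\<^sup>2)))
        * C_const \<sigma> \<beta>
        * (max 1 (Linf_norm I f + Linf_norm I g) / ennreal (min \<gamma> (\<gamma>\<^sup>2)))
        * mixed_norm (\<beta> / 2) (\<lambda>x \<xi>.
            (cmod (STLCT A (chirped_gauss \<sigma> A) f x \<xi>))\<^sup>2 -
            (cmod (STLCT A (chirped_gauss \<sigma> A) g x \<xi>))\<^sup>2)"
proof -
  let ?M = "mixed_norm (\<beta> / 2) (\<lambda>x \<xi>. (cmod (STLCT A (chirped_gauss \<sigma> A) f x \<xi>))\<^sup>2 - (cmod (STLCT A (chirped_gauss \<sigma> A) g x \<xi>))\<^sup>2)"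
  define E where "E = ennreal (sqrt 2 * exp (r\<^sup>2 / (4 * \<sigma>\<^sup>2))) * C_const \<sigma> \<beta> * ?M"
  define m where "m = min \<gamma> (\<gamma>\<^sup>2)"
  have m: "m > 0" using assms(8) by (simp add: m_def)
  note f = assms(5) and g = assms(12) and I = assms(11)
  have cf: "continuous_on UNIV f" and cg: "continuous_on UNIV g"
    using gauss_SIS_continuous[OF assms(1,2)] f g by auto
  have gap: "p (j + 1) - p j \<le> r" if "j \<in> {1..J - 1}" for j
    unfolding assms(10) by (rule Max_ge) (use that in auto)
  have gap_pos: "0 < p (j + 1) - p j" if "j \<in> {1..J - 1}" for j
    using strict_mono_onD[OF assms(7), of j "j + 1"] that by auto
  have r: "r > 0" 
  proof -
    have "1 \<in> {1..J - 1}" using assms(6) by auto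
    then show ?thesis using gap[of 1] gap_pos[of 1] by linarith
  qed
  have "p 1 < p J" using strict_mono_onD[OF assms(7), of 1 J] assms(6) by auto
  then have ends: "p 1 - r < p J + r" using r by linarith
  obtain NF where NF: "NF \<ge> 0" "Linf_norm I f = ennreal NF" using Linf_norm_finite[OF cf] unfolding I by blast
  obtain NG where NG: "NG \<ge> 0" "Linf_norm I g = ennreal NG" using Linf_norm_finite[OF cg] unfolding I by blast
  define X where "X = max 1 (NF + NG)"
  have X: "max 1 (Linf_norm I f + Linf_norm I g) = ennreal X"
  proof -
    have "Linf_norm I f + Linf_norm I g = ennreal (NF + NG)" using NF NG by simp
    then show ?thesis
      using NF(1) NG(1) by (cases "NF + NG \<le> 1") (simp_all add: X_def max_def ennreal_le_1 del: ennreal_plus)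
  qed
  have X1: "X \<ge> 1" by (simp add: X_def)
  have Xm: "ennreal X / ennreal m = ennreal (X / m)"
    using X1 m by (intro divide_ennreal) auto
  define N where "N = real_of_int \<lceil>real J / 2\<rceil>"
  \<comment> \<open>As J div 2 \<ge> 1, the left side of the second claim is at most 4 (J div 2)
    \<le> 4 N, hence at most 16/3 N.\<close>
  have N: "N \<ge> 1" "2 + 2 * real (J div 2) \<le> 16 / 3 * N"
  proof -
    have "real (J div 2) \<le> real J / 2" by linarith
    then have "real (J div 2) \<le> N" unfolding N_def by linarith
    moreover have "1 \<le> real (J div 2)" using assms(6) by auto
    ultimately show "N \<ge> 1" "2 + 2 * real (J div 2) \<le> 16 / 3 * N" by linarith+
  qed
  have rhs: "ennreal (16 * sqrt 2 / 3 * of_int \<lceil>real J / 2\<rceil> * exp (r\<^sup>2 / (4 * \<sigma>\<^sup>2))) * C_const \<sigma> \<beta>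
        * (max 1 (Linf_norm I f + Linf_norm I g) / ennreal (min \<gamma> (\<gamma>\<^sup>2))) * ?M
      = ennreal (16 / 3 * N * (X / m)) * E" (is "?R = _")
  proof -
    have "16 * sqrt 2 / 3 * of_int \<lceil>real J / 2\<rceil> * exp (r\<^sup>2 / (4 * \<sigma>\<^sup>2)) = (16 / 3 * N) * (sqrt 2 * exp (r\<^sup>2 / (4 * \<sigma>\<^sup>2)))"
      by (simp add: N_def)
    then have "ennreal (16 * sqrt 2 / 3 * of_int \<lceil>real J / 2\<rceil> * exp (r\<^sup>2 / (4 * \<sigma>\<^sup>2))) = ennreal (16 / 3 * N) * ennreal (sqrt 2 * exp (r\<^sup>2 / (4 * \<sigma>\<^sup>2)))"
      using N by (simp only: ennreal_mult')
    moreover have "ennreal (16 / 3 * N * (X / m)) = ennreal (16 / 3 * N) * ennreal (X / m)"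
      using N by (intro ennreal_mult') simp
    ultimately show ?thesis unfolding E_def X m_def[symmetric] Xm by (simp only: mult_ac)
  qed
  obtain \<tau> where \<tau>: "is_arg_min (\<lambda>\<tau>. Linf_norm I (\<lambda>t. f t - \<tau> * g t)) (\<lambda>\<tau>. cmod \<tau> = 1) \<tau>"
    using Linf_norm_arg_min_exists[OF cf cg ends] unfolding I by blast
  have "Linf_norm I (\<lambda>t. f t - \<tau> * g t) \<le> ennreal (16 / 3 * N * (X / m)) * E"
  proof (cases "E = \<infinity>")
    case True
    have "16 / 3 * N * (X / m) > 0" using N m X1 by simp
    then have "ennreal (16 / 3 * N * (X / m)) \<noteq> 0" by (simp only: ennreal_eq_0_iff not_le)
    then show ?thesis unfolding True infinity_ennreal_def by (simp only: ennreal_mult_top top_greatest if_False)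
  next
    case False
    then obtain \<epsilon> where \<epsilon>: "E = ennreal \<epsilon>" "\<epsilon> \<ge> 0" by (cases E) auto
    have est: "cmod (f s * cnj (f t) - g s * cnj (g t)) \<le> \<epsilon>" if "\<bar>s - t\<bar> \<le> r" for s t
    proof -
      have "(s - t)\<^sup>2 \<le> r\<^sup>2" using that r by (simp add: abs_le_square_iff[symmetric])
      then have "sqrt 2 * exp ((s - t)\<^sup>2 / (4 * \<sigma>\<^sup>2)) \<le> sqrt 2 * exp (r\<^sup>2 / (4 * \<sigma>\<^sup>2))"
        by (simp add: divide_right_mono)
      then have "ennreal (sqrt 2 * exp ((s - t)\<^sup>2 / (4 * \<sigma>\<^sup>2))) * C_const \<sigma> \<beta> * ?M \<le> E"
        unfolding E_def by (intro mult_right_mono ennreal_leI) auto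
      then have "ennreal (cmod (f s * cnj (f t) - g s * cnj (g t))) \<le> ennreal \<epsilon>"
        using bilinear_estimate[OF assms(1,2) f g assms(4), of s t] unfolding \<epsilon>(1)[symmetric] by (rule order_trans[rotated])
      then show ?thesis using \<epsilon>(2) by (simp add: ennreal_le_iff)
    qed
    have "\<exists>\<tau>. cmod \<tau> = 1 \<and> (\<forall>t\<in>{p 1 - r..p J + r}.
      cmod (f t - \<tau> * g t) \<le> (2 + 2 * real (J div 2)) * (max 1 (NF + NG) / min \<gamma> (\<gamma>\<^sup>2)) * \<epsilon>)"
    proof (rule global_phase[OF assms(6)])
      show "\<bar>p (j + 1) - p j\<bar> \<le> r" if "j \<in> {1..J - 1}" for j using gap[OF that] gap_pos[OF that] by simp
      show "cmod (f t) \<le> NF" if "t \<in> {p 1 - r..p J + r}" for t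
        using le_Linf_norm[OF cf ends that] NF unfolding I by (simp add: ennreal_le_iff)
      show "cmod (g t) \<le> NG" if "t \<in> {p 1 - r..p J + r}" for t
        using le_Linf_norm[OF cg ends that] NG unfolding I by (simp add: ennreal_le_iff)
    qed (use assms r NF NG est in auto)
    then obtain \<tau>' where \<tau>': "cmod \<tau>' = 1"
      "\<And>t. t \<in> I \<Longrightarrow> cmod (f t - \<tau>' * g t) \<le> (2 + 2 * real (J div 2)) * (X / m) * \<epsilon>"
      unfolding I X_def m_def by blast
    \<comment> \<open>The phase \<tau>' from \<open>global_phase\<close> need not be the minimizer,
      but it bounds the minimum.\<close>
    have "Linf_norm I (\<lambda>t. f t - \<tau> * g t) \<le> Linf_norm I (\<lambda>t. f t - \<tau>' * g t)"
      using \<tau> \<tau>'(1) by (auto simp: is_arg_min_def not_less)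
    also have "\<dots> \<le> ennreal (16 / 3 * N * (X / m) * \<epsilon>)"
    proof (rule Linf_norm_le)
      show "continuous_on UNIV (\<lambda>t. f t - \<tau>' * g t)" by (intro continuous_intros cf cg)
      show "I \<in> sets borel" unfolding I by simp
      fix t assume "t \<in> I"
      from \<tau>'(2)[OF this] have "cmod (f t - \<tau>' * g t) \<le> (2 + 2 * real (J div 2)) * (X / m * \<epsilon>)" by simp
      also have "\<dots> \<le> 16 / 3 * N * (X / m * \<epsilon>)"
        using N \<epsilon>(2) m X1 by (intro mult_right_mono) auto
      finally show "ennreal (cmod (f t - \<tau>' * g t)) \<le> ennreal (16 / 3 * N * (X / m) * \<epsilon>)"
        by (intro ennreal_leI) simp
    qed
    also have "\<dots> = ennreal (16 / 3 * N * (X / m)) * E"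
      unfolding \<epsilon>(1) using N m X1 by (intro ennreal_mult') auto
    finally show ?thesis .
  qed
  then show ?thesis using \<tau> unfolding rhs by blast
qed

end
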